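(* Let $\mathbb{F}$ be a field, let $k,l\in\mathbb{N}$, let $X=\{x_i:i\in[n]\}$ be variables, let $a_1,\dots,a_n\in\mathbb{F}$ be distinct, and let $Z\subseteq\mathbb{F}$ be a set of at least $n-k-l-1$ nonzero field elements. A multilinear polynomial $p\in\mathbb{F}[X]$ belongs to the vanishing ideal $I(\mathrm{RFE}_{k,l})$ if and only if both of the following hold: (1) $p$ contains no monomial of degree at most $l$, and no monomial of degree at least $n-k$; (2) for all disjoint subsets $K,L\subseteq[n]$ with $|K|=k$ and $|L|=l$, and every $z\in Z$, the polynomial $\partial_L p|_{K\gets 0}$ evaluates to zero under the substitution, for each $i\in[n]\setminus(K\cup L)$, \[ x_i\gets z\cdot\frac{\prod_{j\in K}(a_i-a_j)}{\prod_{j\in L}(a_i-a_j)}. \]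
   Context: The Rational Function Evaluation generator $\mathrm{RFE}_{k,l}$ with distinct abscissas $a_1,\dots,a_n$ takes as seed a rational function $f=g/h\in\mathbb{F}(\alpha)$ with $\deg g\le k$, $\deg h\le l$, $h(a_i)\neq 0$ for all $i$, and substitutes $x_i\gets f(a_i)$. Its vanishing ideal $I(\mathrm{RFE}_{k,l})$ is the set of $p\in\mathbb{F}[X]$ with $p(f(a_1),\dots,f(a_n))=0$ for all seeds (the field is assumed sufficiently large; equivalently, $p(g(a_1)/h(a_1),\dots,g(a_n)/h(a_n))$ vanishes identically when the coefficients of $g,h$ are indeterminates). For $K,L\subseteq[n]$ disjoint, $\partial_L p|_{K\gets0}$ denotes the polynomial obtained from $p$ by taking the partial derivative with respect to every variable $x_j$, $j\in L$, and setting every variable $x_j$, $j\in K$, to zero; it depends only on the variables $x_i$ with $i\notin K\cup L$. *)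

theory Defs
  imports
    "HOL-Library.Poly_Mapping"
    "HOL-Computational_Algebra.Polynomial_Factorial"
begin

text \<open>
  Multivariate polynomials: finitely supported maps from monomials (exponent vectors) to
  coefficients.  Variables are indexed by all of \<open>nat\<close>; \<open>mpolys n\<close> below
  is \<open>F[x\<^sub>1, \<dots>, x\<^sub>n]\<close>.
\<close>

type_synonym monomial = "nat \<Rightarrow>\<^sub>0 nat"
type_synonym 'a mpoly = "monomial \<Rightarrow>\<^sub>0 'a"

definition mconst :: "'a::zero \<Rightarrow> 'a mpoly" where
  "mconst c = Poly_Mapping.single 0 c"

definition mvar :: "nat \<Rightarrow> 'a::{zero,one} mpoly" where
  "mvar i = Poly_Mapping.single (Poly_Mapping.single i 1) 1"

definition mpolys :: "nat \<Rightarrow> 'a::zero mpoly set" where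
  "mpolys n = {p. \<forall>m \<in> Poly_Mapping.keys p. Poly_Mapping.keys m \<subseteq> {1..n}}"

definition monomial_degree :: "monomial \<Rightarrow> nat" where
  "monomial_degree m = (\<Sum>i\<in>Poly_Mapping.keys m. Poly_Mapping.lookup m i)"

definition multilinear :: "'a::zero mpoly \<Rightarrow> bool" where
  "multilinear p \<longleftrightarrow> (\<forall>m \<in> Poly_Mapping.keys p. \<forall>i. Poly_Mapping.lookup m i \<le> 1)"

text \<open>
  Substitution \<open>x\<^sub>i \<leftarrow> x i\<close> with values in an algebra over the coefficients whose
  structure map is \<open>\<phi>\<close>.
\<close>

definition mpoly_eval ::
    "('a::zero \<Rightarrow> 'b::comm_semiring_1) \<Rightarrow> (nat \<Rightarrow> 'b) \<Rightarrow> 'a mpoly \<Rightarrow> 'b" where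
  "mpoly_eval \<phi> x p =
     (\<Sum>m\<in>Poly_Mapping.keys p.
        \<phi> (Poly_Mapping.lookup p m) *
        (\<Prod>i\<in>Poly_Mapping.keys m. x i ^ Poly_Mapping.lookup m i))"

definition mpoly_pderiv :: "nat \<Rightarrow> 'a::comm_semiring_1 mpoly \<Rightarrow> 'a mpoly" where
  "mpoly_pderiv j p =
     (\<Sum>m\<in>Poly_Mapping.keys p.
        Poly_Mapping.single (m - Poly_Mapping.single j 1)
          (of_nat (Poly_Mapping.lookup m j) * Poly_Mapping.lookup p m))"

text \<open>Partial derivatives commute, so the order of differentiation is immaterial.\<close>

definition mpoly_pderivs :: "nat set \<Rightarrow> 'a::comm_semiring_1 mpoly \<Rightarrow> 'a mpoly" where
  "mpoly_pderivs L p = fold mpoly_pderiv (sorted_list_of_set L) p"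

definition mpoly_set_zero :: "nat set \<Rightarrow> 'a::comm_semiring_1 mpoly \<Rightarrow> 'a mpoly" where
  "mpoly_set_zero K p = mpoly_eval mconst (\<lambda>i. if i \<in> K then 0 else mvar i) p"

text \<open>
  The generic seed \<open>g/h\<close>: the coefficients of \<open>g\<close> and \<open>h\<close> are distinct
  indeterminates (\<open>mvar 0, \<dots>, mvar k\<close> for \<open>g\<close>, and
  \<open>mvar (k + 1), \<dots>, mvar (k + 1 + l)\<close> for \<open>h\<close>) in the field of rational
  functions over the coefficient field.  Quantifying over seeds with coefficients in the
  coefficient field itself would give a larger ideal over small finite fields; over infinite
  fields both definitions agree, see \<open>rfe_vanishing_ideal_iff_seeds\<close>.
\<close>

definition rfe_num :: "nat \<Rightarrow> 'a::field mpoly fract poly" where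
  "rfe_num k = (\<Sum>j\<le>k. monom (to_fract (mvar j)) j)"

definition rfe_den :: "nat \<Rightarrow> nat \<Rightarrow> 'a::field mpoly fract poly" where
  "rfe_den k l = (\<Sum>j\<le>l. monom (to_fract (mvar (k + 1 + j))) j)"

definition rfe_value :: "(nat \<Rightarrow> 'a::field) \<Rightarrow> nat \<Rightarrow> nat \<Rightarrow> nat \<Rightarrow> 'a mpoly fract" where
  "rfe_value a k l i =
     poly (rfe_num k) (to_fract (mconst (a i))) / poly (rfe_den k l) (to_fract (mconst (a i)))"

definition rfe_vanishing_ideal ::
    "nat \<Rightarrow> (nat \<Rightarrow> 'a::field) \<Rightarrow> nat \<Rightarrow> nat \<Rightarrow> 'a mpoly set" where
  "rfe_vanishing_ideal n a k l =
     {p \<in> mpolys n. mpoly_eval (\<lambda>c. to_fract (mconst c)) (rfe_value a k l) p = 0}"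


definition rfe_seed ::
    "nat \<Rightarrow> (nat \<Rightarrow> 'a::field) \<Rightarrow> nat \<Rightarrow> nat \<Rightarrow> 'a poly \<Rightarrow> 'a poly \<Rightarrow> bool" where
  "rfe_seed n a k l g h \<longleftrightarrow>
     degree g \<le> k \<and> degree h \<le> l \<and> (\<forall>i\<in>{1..n}. poly h (a i) \<noteq> 0)"

definition comm_ring_hom_fun :: "('a::comm_ring_1 \<Rightarrow> 'b::comm_ring_1) \<Rightarrow> bool" where
  "comm_ring_hom_fun \<phi> \<longleftrightarrow>
     \<phi> 0 = 0 \<and> \<phi> 1 = 1 \<and> (\<forall>x y. \<phi> (x + y) = \<phi> x + \<phi> y) \<and> (\<forall>x y. \<phi> (x * y) = \<phi> x * \<phi> y)"

lemma hom_sum: "comm_ring_hom_fun \<phi> \<Longrightarrow> \<phi> (sum f A) = (\<Sum>x\<in>A. \<phi> (f x))"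
  by (induction A rule: infinite_finite_induct) (auto simp: comm_ring_hom_fun_def)

lemma hom_prod: "comm_ring_hom_fun \<phi> \<Longrightarrow> \<phi> (prod f A) = (\<Prod>x\<in>A. \<phi> (f x))"
  by (induction A rule: infinite_finite_induct) (auto simp: comm_ring_hom_fun_def)

lemma hom_power: "comm_ring_hom_fun \<phi> \<Longrightarrow> \<phi> (x ^ n) = \<phi> x ^ n"
  by (induction n) (auto simp: comm_ring_hom_fun_def)

lemma hom_to_fract: "comm_ring_hom_fun to_fract"
  by (simp add: comm_ring_hom_fun_def)

lemma monomial_value_superset:
  fixes x :: "nat \<Rightarrow> 'b::comm_semiring_1"
  assumes "finite A" "Poly_Mapping.keys m \<subseteq> A"
  shows "(\<Prod>i\<in>Poly_Mapping.keys m. x i ^ Poly_Mapping.lookup m i) =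
         (\<Prod>i\<in>A. x i ^ Poly_Mapping.lookup m i)"
  by (rule prod.mono_neutral_left) (use assms in \<open>auto simp: in_keys_iff\<close>)

lemma monomial_value_add:
  fixes x :: "nat \<Rightarrow> 'b::comm_semiring_1"
  shows "(\<Prod>i\<in>Poly_Mapping.keys (m + m'). x i ^ Poly_Mapping.lookup (m + m') i) =
         (\<Prod>i\<in>Poly_Mapping.keys m. x i ^ Poly_Mapping.lookup m i) *
         (\<Prod>i\<in>Poly_Mapping.keys m'. x i ^ Poly_Mapping.lookup m' i)"
proof -
  let ?A = "Poly_Mapping.keys m \<union> Poly_Mapping.keys m'"
  have "Poly_Mapping.keys (m + m') \<subseteq> ?A" by (rule Poly_Mapping.keys_add)
  then show ?thesis
    by (subst (1 2 3) monomial_value_superset[of ?A])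
      (simp_all add: lookup_add power_add prod.distrib)
qed

lemma mpoly_eval_superset:
  assumes "finite A" "Poly_Mapping.keys p \<subseteq> A" "\<phi> 0 = 0"
  shows "mpoly_eval \<phi> x p = (\<Sum>m\<in>A. \<phi> (Poly_Mapping.lookup p m) *
        (\<Prod>i\<in>Poly_Mapping.keys m. x i ^ Poly_Mapping.lookup m i))"
  unfolding mpoly_eval_def
  by (rule sum.mono_neutral_left) (use assms in \<open>auto simp: in_keys_iff\<close>)

lemma mpoly_eval_add:
  assumes "comm_ring_hom_fun \<phi>"
  shows "mpoly_eval \<phi> x (p + q) = mpoly_eval \<phi> x p + mpoly_eval \<phi> x q"
proof -
  let ?A = "Poly_Mapping.keys p \<union> Poly_Mapping.keys q"
  have "Poly_Mapping.keys (p + q) \<subseteq> ?A" by (rule Poly_Mapping.keys_add)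
  moreover have "\<phi> 0 = 0" using assms by (simp add: comm_ring_hom_fun_def)
  ultimately show ?thesis
    using assms
    by (simp add: mpoly_eval_superset[of ?A] lookup_add comm_ring_hom_fun_def
        distrib_right sum.distrib)
qed

lemma mpoly_eval_0: "mpoly_eval \<phi> x 0 = 0"
  by (simp add: mpoly_eval_def)

lemma mpoly_eval_sum:
  assumes "comm_ring_hom_fun \<phi>"
  shows "mpoly_eval \<phi> x (sum f A) = (\<Sum>i\<in>A. mpoly_eval \<phi> x (f i))"
  by (induction A rule: infinite_finite_induct) (auto simp: mpoly_eval_0 mpoly_eval_add[OF assms])

lemma mpoly_eval_single:
  assumes "comm_ring_hom_fun \<phi>"
  shows "mpoly_eval \<phi> x (Poly_Mapping.single m c) =
    \<phi> c * (\<Prod>i\<in>Poly_Mapping.keys m. x i ^ Poly_Mapping.lookup m i)"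
  using assms by (simp add: mpoly_eval_def comm_ring_hom_fun_def)

lemma sum_single_keys:
  "(\<Sum>m\<in>Poly_Mapping.keys p. Poly_Mapping.single m (Poly_Mapping.lookup p m)) = p"
  by (rule poly_mapping_eqI)
    (auto simp: lookup_sum lookup_single when_def in_keys_iff)

lemma mpoly_eval_mult:
  assumes "comm_ring_hom_fun \<phi>"
  shows "mpoly_eval \<phi> x (p * q) = mpoly_eval \<phi> x p * mpoly_eval \<phi> x q"
proof -
  have hm: "\<phi> (c * d) = \<phi> c * \<phi> d" for c d using assms by (simp add: comm_ring_hom_fun_def)
  let ?s = "\<lambda>p m. Poly_Mapping.single m (Poly_Mapping.lookup p m)"
  let ?K = "Poly_Mapping.keys"
  have "p * q = (\<Sum>m\<in>?K p. ?s p m) * (\<Sum>m\<in>?K q. ?s q m)"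
    by (simp add: sum_single_keys)
  also have "\<dots> = (\<Sum>m\<in>?K p. \<Sum>m'\<in>?K q.
      Poly_Mapping.single (m + m') (Poly_Mapping.lookup p m * Poly_Mapping.lookup q m'))"
    by (simp add: sum_product mult_single)
  finally have "mpoly_eval \<phi> x (p * q) = (\<Sum>m\<in>?K p. \<Sum>m'\<in>?K q.
      mpoly_eval \<phi> x (Poly_Mapping.single (m + m')
        (Poly_Mapping.lookup p m * Poly_Mapping.lookup q m')))"
    by (simp only: mpoly_eval_sum[OF assms])
  also have "\<dots> = (\<Sum>m\<in>?K p. \<Sum>m'\<in>?K q.
      mpoly_eval \<phi> x (?s p m) * mpoly_eval \<phi> x (?s q m'))"
    by (intro sum.cong refl)
      (simp only: mpoly_eval_single[OF assms] monomial_value_add hm mult.assoc mult.commute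
        mult.left_commute)
  also have "\<dots> = mpoly_eval \<phi> x (\<Sum>m\<in>?K p. ?s p m) * mpoly_eval \<phi> x (\<Sum>m\<in>?K q. ?s q m)"
    by (simp only: mpoly_eval_sum[OF assms] sum_product)
  finally show ?thesis by (simp only: sum_single_keys)
qed

lemma hom_mpoly_eval:
  assumes "comm_ring_hom_fun \<phi>"
  shows "comm_ring_hom_fun (mpoly_eval \<phi> x)"
proof -
  have "mpoly_eval \<phi> x 1 = 1"
    using mpoly_eval_single[OF assms, of x 0 1] assms by (simp add: comm_ring_hom_fun_def)
  then show ?thesis
    using mpoly_eval_add[OF assms] mpoly_eval_mult[OF assms]
    by (simp add: comm_ring_hom_fun_def mpoly_eval_0)
qed

lemma mpoly_eval_mconst: "comm_ring_hom_fun \<phi> \<Longrightarrow> mpoly_eval \<phi> x (mconst c) = \<phi> c"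
  by (simp add: mconst_def mpoly_eval_single)

lemma mpoly_eval_mvar: "comm_ring_hom_fun \<phi> \<Longrightarrow> mpoly_eval \<phi> x (mvar i) = x i"
  unfolding mvar_def mpoly_eval_single by (simp add: comm_ring_hom_fun_def)

lemma monomial_split:
  fixes x :: "nat \<Rightarrow> 'a::comm_semiring_1"
  shows "(\<Prod>i\<in>Poly_Mapping.keys m. x i ^ Poly_Mapping.lookup m i) =
    x v ^ Poly_Mapping.lookup m v *
    (\<Prod>i\<in>Poly_Mapping.keys (m - Poly_Mapping.single v (Poly_Mapping.lookup m v)).
       x i ^ Poly_Mapping.lookup (m - Poly_Mapping.single v (Poly_Mapping.lookup m v)) i)"
proof -
  let ?s = "Poly_Mapping.single v (Poly_Mapping.lookup m v)"
  have split: "?s + (m - ?s) = m"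
    by (rule poly_mapping_eqI) (simp add: lookup_add lookup_minus lookup_single when_def)
  have "(\<Prod>i\<in>Poly_Mapping.keys ?s. x i ^ Poly_Mapping.lookup ?s i) =
      x v ^ Poly_Mapping.lookup m v"
    by (cases "Poly_Mapping.lookup m v = 0") simp_all
  then show ?thesis using monomial_value_add[of x ?s "m - ?s"] by (simp only: split)
qed

lemma mpoly_eq_0_if_eval_0:
  fixes p :: "'a::field mpoly"
  assumes inf: "infinite (UNIV :: 'a set)" and "finite V"
    and "\<forall>m\<in>Poly_Mapping.keys p. Poly_Mapping.keys m \<subseteq> V"
    and "\<And>x. mpoly_eval (\<lambda>c. c) x p = 0"
  shows "p = 0"
  using assms(2-)
proof (induction V arbitrary: p rule: finite_induct)
  case empty
  have "Poly_Mapping.keys p \<subseteq> {0}" using empty.prems(1) by auto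
  then have "mpoly_eval (\<lambda>c. c) (\<lambda>_. 0) p = Poly_Mapping.lookup p 0"
    by (subst mpoly_eval_superset[of "{0}"]) auto
  then have "Poly_Mapping.lookup p 0 = 0" using empty.prems(2) by simp
  with \<open>Poly_Mapping.keys p \<subseteq> {0}\<close> have "Poly_Mapping.keys p = {}"
    by (metis in_keys_iff ex_in_conv singletonD subsetD)
  then show ?case by simp
next
  case (insert v V)
  have hid: "comm_ring_hom_fun (\<lambda>c::'a. c)" by (simp add: comm_ring_hom_fun_def)
  let ?K = "Poly_Mapping.keys p"
  define r where "r m = m - Poly_Mapping.single v (Poly_Mapping.lookup m v)" for m :: monomial
  define P where "P e = (\<Sum>m\<in>{m\<in>?K. Poly_Mapping.lookup m v = e}.
    Poly_Mapping.single (r m) (Poly_Mapping.lookup p m))" for e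
  have lr: "Poly_Mapping.lookup (r m) i = (if i = v then 0 else Poly_Mapping.lookup m i)" for m i
    by (auto simp: r_def lookup_minus lookup_single when_def)
  have P0: "P e = 0" for e
  proof (rule insert.IH)
    show "\<forall>m\<in>Poly_Mapping.keys (P e). Poly_Mapping.keys m \<subseteq> V"
    proof
      fix m assume "m \<in> Poly_Mapping.keys (P e)"
      then obtain m' where m': "m' \<in> ?K" "m = r m'"
        unfolding P_def using keys_sum by (fastforce split: if_splits)
      have "Poly_Mapping.keys m' \<subseteq> insert v V" using insert.prems(1) m' by auto
      then show "Poly_Mapping.keys m \<subseteq> V"
        using m'(2) lr by (auto simp: in_keys_iff subset_iff split: if_splits)
    qed
  next
    fix x :: "nat \<Rightarrow> 'a"
    define E where "E = (\<lambda>m. Poly_Mapping.lookup m v) ` ?K"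
    have finE: "finite E" by (simp add: E_def)
    define R where "R m y = (\<Prod>i\<in>Poly_Mapping.keys (r m). y i ^ Poly_Mapping.lookup (r m) i)"
      for m and y :: "nat \<Rightarrow> 'a"
    have Rupd: "R m (x(v := t)) = R m x" for m t
      unfolding R_def by (rule prod.cong) (auto simp: lr in_keys_iff split: if_splits)
    have PE: "mpoly_eval (\<lambda>c. c) x (P e) =
        (\<Sum>m\<in>{m\<in>?K. Poly_Mapping.lookup m v = e}. Poly_Mapping.lookup p m * R m x)" for e
      unfolding P_def by (simp add: mpoly_eval_sum[OF hid] mpoly_eval_single[OF hid] R_def)
    define q where "q = (\<Sum>e\<in>E. monom (mpoly_eval (\<lambda>c. c) x (P e)) e)"
    have "poly q t = 0" for t
    proof -
      have "0 = mpoly_eval (\<lambda>c. c) (x(v := t)) p" by (simp add: insert.prems(2))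
      also have "\<dots> = (\<Sum>m\<in>?K. Poly_Mapping.lookup p m * (t ^ Poly_Mapping.lookup m v * R m x))"
        unfolding mpoly_eval_def
        by (subst monomial_split[of _ _ v])
          (simp only: fun_upd_same Rupd flip: r_def R_def)
      also have "\<dots> = (\<Sum>e\<in>E. \<Sum>m\<in>{m\<in>?K. Poly_Mapping.lookup m v = e}.
          Poly_Mapping.lookup p m * (t ^ Poly_Mapping.lookup m v * R m x))"
        by (rule sum.group[symmetric]) (auto simp: E_def)
      also have "\<dots> = poly q t"
        unfolding q_def poly_sum poly_monom PE
        by (rule sum.cong[OF refl]) (auto simp: sum_distrib_left mult_ac intro!: sum.cong)
      finally show ?thesis by simp
    qed
    then have "{t. poly q t = 0} = UNIV" by auto
    then have "q = 0" using inf poly_roots_finite[of q] by auto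
    have "coeff q e = (if e \<in> E then mpoly_eval (\<lambda>c. c) x (P e) else 0)"
      unfolding q_def coeff_sum using finE by (simp add: sum.delta)
    moreover have "P e = 0" if "e \<notin> E"
      unfolding P_def using that by (intro sum.neutral) (auto simp: E_def)
    ultimately show "mpoly_eval (\<lambda>c. c) x (P e) = 0"
      using \<open>q = 0\<close> by (auto simp: mpoly_eval_0 split: if_splits)
  qed
  show "p = 0"
  proof (rule poly_mapping_eqI)
    fix m
    have "Poly_Mapping.lookup (P (Poly_Mapping.lookup m v)) (r m) = Poly_Mapping.lookup p m"
    proof -
      have eq: "r m' = r m \<longleftrightarrow> m' = m" if "Poly_Mapping.lookup m' v = Poly_Mapping.lookup m v" for m'
      proof
        assume "r m' = r m"
        then have "Poly_Mapping.lookup (r m') i = Poly_Mapping.lookup (r m) i" for i by simp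
        then show "m' = m" using that
          by (intro poly_mapping_eqI) (metis lr)
      qed simp
      have "Poly_Mapping.lookup (P (Poly_Mapping.lookup m v)) (r m) =
        (\<Sum>m'\<in>{m'\<in>?K. Poly_Mapping.lookup m' v = Poly_Mapping.lookup m v}.
           if m' = m then Poly_Mapping.lookup p m' else 0)"
        unfolding P_def lookup_sum
        by (intro sum.cong refl) (auto simp: lookup_single when_def eq)
      also have "\<dots> = Poly_Mapping.lookup p m"
        by (subst sum.delta) (auto simp: in_keys_iff)
      finally show ?thesis .
    qed
    then show "Poly_Mapping.lookup p m = Poly_Mapping.lookup 0 m" by (simp add: P0)
  qed
qed

lemma mpoly_eval_clear_denominators:
  fixes G H :: "nat \<Rightarrow> 'b::field"
  assumes "p \<in> mpolys n" "\<And>m i. m \<in> Poly_Mapping.keys p \<Longrightarrow> Poly_Mapping.lookup m i \<le> N"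
    and "\<And>i. i \<in> {1..n} \<Longrightarrow> H i \<noteq> 0"
  shows "mpoly_eval \<phi> (\<lambda>i. G i / H i) p * (\<Prod>i\<in>{1..n}. H i ^ N) =
    (\<Sum>m\<in>Poly_Mapping.keys p. \<phi> (Poly_Mapping.lookup p m) *
       (\<Prod>i\<in>{1..n}. G i ^ Poly_Mapping.lookup m i * H i ^ (N - Poly_Mapping.lookup m i)))"
  unfolding mpoly_eval_def sum_distrib_right
proof (rule sum.cong[OF refl])
  fix m assume m: "m \<in> Poly_Mapping.keys p"
  have "Poly_Mapping.keys m \<subseteq> {1..n}" using assms(1) m by (auto simp: mpolys_def)
  then have "(\<Prod>i\<in>Poly_Mapping.keys m. (G i / H i) ^ Poly_Mapping.lookup m i) *
      (\<Prod>i\<in>{1..n}. H i ^ N) =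
    (\<Prod>i\<in>{1..n}. (G i / H i) ^ Poly_Mapping.lookup m i * H i ^ N)"
    by (simp add: monomial_value_superset[of "{1..n}"] prod.distrib)
  also have "\<dots> =
    (\<Prod>i\<in>{1..n}. G i ^ Poly_Mapping.lookup m i * H i ^ (N - Poly_Mapping.lookup m i))"
  proof (rule prod.cong[OF refl])
    fix i assume "i \<in> {1..n}"
    then show "(G i / H i) ^ Poly_Mapping.lookup m i * H i ^ N =
      G i ^ Poly_Mapping.lookup m i * H i ^ (N - Poly_Mapping.lookup m i)"
      using assms(2)[OF m, of i] assms(3)[of i] by (simp add: power_divide power_diff)
  qed
  finally show "\<phi> (Poly_Mapping.lookup p m) *
      (\<Prod>i\<in>Poly_Mapping.keys m. (G i / H i) ^ Poly_Mapping.lookup m i) * (\<Prod>i\<in>{1..n}. H i ^ N) =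
    \<phi> (Poly_Mapping.lookup p m) *
    (\<Prod>i\<in>{1..n}. G i ^ Poly_Mapping.lookup m i * H i ^ (N - Poly_Mapping.lookup m i))"
    by (simp add: mult.assoc)
qed

theorem rfe_vanishing_ideal_iff_seeds:
  fixes a :: "nat \<Rightarrow> 'a::field"
  assumes inf: "infinite (UNIV :: 'a set)"
  shows "rfe_vanishing_ideal n a k l =
    {p \<in> mpolys n. \<forall>g h. rfe_seed n a k l g h \<longrightarrow>
       mpoly_eval (\<lambda>c. c) (\<lambda>i. poly g (a i) / poly h (a i)) p = 0}"
proof -
  have hid: "comm_ring_hom_fun (\<lambda>c::'a. c)" by (simp add: comm_ring_hom_fun_def)
  have "mpoly_eval (\<lambda>c. to_fract (mconst c)) (rfe_value a k l) p = 0 \<longleftrightarrow>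
    (\<forall>g h. rfe_seed n a k l g h \<longrightarrow>
       mpoly_eval (\<lambda>c. c) (\<lambda>i. poly g (a i) / poly h (a i)) p = 0)"
    if p: "p \<in> mpolys n" for p :: "'a mpoly"
  proof -
    let ?ev = "\<lambda>u. mpoly_eval (\<lambda>c::'a. c) u"
    note hev = hom_mpoly_eval[OF hid]
    define G :: "nat \<Rightarrow> 'a mpoly" where "G i = (\<Sum>j\<le>k. mvar j * mconst (a i) ^ j)" for i
    define H :: "nat \<Rightarrow> 'a mpoly" where "H i = (\<Sum>j\<le>l. mvar (k + 1 + j) * mconst (a i) ^ j)" for i
    define gu where "gu u = (\<Sum>j\<le>k. monom (u j) j)" for u :: "nat \<Rightarrow> 'a"
    define hu where "hu u = (\<Sum>j\<le>l. monom (u (k + 1 + j)) j)" for u :: "nat \<Rightarrow> 'a"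
    have evm: "?ev u (x * y) = ?ev u x * ?ev u y" for u x y by (rule mpoly_eval_mult[OF hid])
    have evG: "?ev u (G i) = poly (gu u) (a i)" for u i
      by (simp add: G_def gu_def hom_sum[OF hev] evm hom_power[OF hev] mpoly_eval_mconst[OF hid]
          mpoly_eval_mvar[OF hid] poly_sum poly_monom)
    have evH: "?ev u (H i) = poly (hu u) (a i)" for u i
      by (simp add: H_def hu_def hom_sum[OF hev] evm hom_power[OF hev] mpoly_eval_mconst[OF hid]
          mpoly_eval_mvar[OF hid] poly_sum poly_monom)
    have frG: "poly (rfe_num k) (to_fract (mconst (a i))) = to_fract (G i)" for i
      by (simp add: G_def rfe_num_def poly_sum poly_monom hom_sum[OF hom_to_fract]
          hom_power[OF hom_to_fract])
    have frH: "poly (rfe_den k l) (to_fract (mconst (a i))) = to_fract (H i)" for i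
      by (simp add: H_def rfe_den_def poly_sum poly_monom hom_sum[OF hom_to_fract]
          hom_power[OF hom_to_fract])
    have H0: "H i \<noteq> 0" for i
    proof
      assume "H i = 0"
      then have "?ev (\<lambda>j. if j = k + 1 then 1 else 0) (H i) = 0" by (simp add: mpoly_eval_0)
      then have "(\<Sum>j\<le>l. if j = 0 then (1::'a) else 0) = 0"
        unfolding evH hu_def poly_sum poly_monom
        by (simp add: if_distrib[of "\<lambda>y. y * _"] cong: if_cong)
      then show False by simp
    qed
    define N where "N = (\<Sum>m\<in>Poly_Mapping.keys p. monomial_degree m)"
    have N: "Poly_Mapping.lookup m i \<le> N" if "m \<in> Poly_Mapping.keys p" for m i
    proof -
      have "Poly_Mapping.lookup m i \<le> monomial_degree m"
        unfolding monomial_degree_def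
        by (cases "i \<in> Poly_Mapping.keys m") (auto simp: in_keys_iff intro: member_le_sum)
      also have "\<dots> \<le> N" unfolding N_def using that by (intro member_le_sum) auto
      finally show ?thesis .
    qed
    define Q where "Q = (\<Sum>m\<in>Poly_Mapping.keys p. mconst (Poly_Mapping.lookup p m) *
       (\<Prod>i\<in>{1..n}. G i ^ Poly_Mapping.lookup m i * H i ^ (N - Poly_Mapping.lookup m i)))"
    have clear: "mpoly_eval (\<lambda>c. to_fract (mconst c)) (\<lambda>i. to_fract (G i) / to_fract (H i)) p *
        (\<Prod>i\<in>{1..n}. to_fract (H i) ^ N) = to_fract Q"
      by (subst mpoly_eval_clear_denominators[OF p N])
        (simp_all add: H0 Q_def hom_sum[OF hom_to_fract] hom_prod[OF hom_to_fract]
          hom_power[OF hom_to_fract])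
    have val: "rfe_value a k l = (\<lambda>i. to_fract (G i) / to_fract (H i))"
      by (simp add: fun_eq_iff rfe_value_def frG frH)
    have nz: "(\<Prod>i\<in>{1..n}. to_fract (H i) ^ N) \<noteq> 0" using H0 by simp
    have cancel: "x = 0 \<longleftrightarrow> z = 0" if "x * y = to_fract z" "y \<noteq> 0"
      for x y and z :: "'a mpoly"
      using that by auto
    have generic:
      "mpoly_eval (\<lambda>c. to_fract (mconst c)) (rfe_value a k l) p = 0 \<longleftrightarrow> Q = 0"
      unfolding val by (rule cancel[OF clear nz])
    have seed: "?ev (\<lambda>i. poly (gu u) (a i) / poly (hu u) (a i)) p *
        (\<Prod>i\<in>{1..n}. poly (hu u) (a i) ^ N) = ?ev u Q"
      if "\<And>i. i \<in> {1..n} \<Longrightarrow> poly (hu u) (a i) \<noteq> 0" for u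
      by (subst mpoly_eval_clear_denominators[OF p N])
        (simp_all add: that[simplified] Q_def hom_sum[OF hev] evm hom_prod[OF hev] hom_power[OF hev]
          mpoly_eval_mconst[OF hid] evG evH)
    have deg: "degree (gu u) \<le> k" "degree (hu u) \<le> l" for u
      unfolding gu_def hu_def
      by (auto intro!: degree_sum_le intro: order_trans[OF degree_monom_le])
    show ?thesis
    proof
      assume "mpoly_eval (\<lambda>c. to_fract (mconst c)) (rfe_value a k l) p = 0"
      then have Q: "Q = 0" using generic by simp
      show "\<forall>g h. rfe_seed n a k l g h \<longrightarrow> ?ev (\<lambda>i. poly g (a i) / poly h (a i)) p = 0"
      proof (intro allI impI)
        fix g h assume gh: "rfe_seed n a k l g h"
        define u where "u j = (if j \<le> k then coeff g j else coeff h (j - (k + 1)))" for j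
        have "gu u = (\<Sum>j\<le>k. monom (coeff g j) j)" "hu u = (\<Sum>j\<le>l. monom (coeff h j) j)"
          unfolding gu_def hu_def by (auto simp: u_def intro!: sum.cong)
        then have "gu u = g" "hu u = h"
          using gh by (simp_all add: poly_as_sum_of_monoms' rfe_seed_def)
        then have "?ev (\<lambda>i. poly g (a i) / poly h (a i)) p *
            (\<Prod>i\<in>{1..n}. poly h (a i) ^ N) = 0"
          using seed[of u] gh Q by (simp add: rfe_seed_def mpoly_eval_0)
        then show "?ev (\<lambda>i. poly g (a i) / poly h (a i)) p = 0"
          using gh by (auto simp: rfe_seed_def)
      qed
    next
      assume all: "\<forall>g h. rfe_seed n a k l g h \<longrightarrow> ?ev (\<lambda>i. poly g (a i) / poly h (a i)) p = 0"
      have "?ev u (Q * (\<Prod>i\<in>{1..n}. H i)) = 0" for u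
      proof (cases "\<forall>i\<in>{1..n}. poly (hu u) (a i) \<noteq> 0")
        case True
        then have "rfe_seed n a k l (gu u) (hu u)" using deg by (simp add: rfe_seed_def)
        then have "?ev u Q = 0" using all seed[of u] True by auto
        then show ?thesis by (simp add: evm)
      next
        case False
        then show ?thesis by (auto simp: evm hom_prod[OF hev] evH)
      qed
      then have "Q * (\<Prod>i\<in>{1..n}. H i) = 0"
        by (intro mpoly_eq_0_if_eval_0[OF inf, of
              "\<Union>(Poly_Mapping.keys ` Poly_Mapping.keys (Q * (\<Prod>i\<in>{1..n}. H i)))"]) auto
      then have "Q = 0" using H0 by simp
      then show "mpoly_eval (\<lambda>c. to_fract (mconst c)) (rfe_value a k l) p = 0"
        using generic by simp
    qed
  qed
  then show ?thesis by (auto simp: rfe_vanishing_ideal_def)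
qed

end

theory Submission
  imports Defs
begin

text \<open>
  Write \<open>p = \<Sum>\<^sub>S c\<^sub>S x\<^sub>S\<close>. After clearing denominators, \<open>p\<close> vanishes on all seeds iff each
  homogeneous component \<open>Q\<^sub>d(g, h) = \<Sum>\<^bsub>|S| = d\<^esub> c\<^sub>S \<Prod>\<^bsub>i \<in> S\<^esub> g(a\<^sub>i) \<Prod>\<^bsub>i \<notin> S\<^esub> h(a\<^sub>i)\<close> vanishes.
  If \<open>h\<close> vanishes on \<open>T\<close> (possible when \<open>|T| \<le> l\<close>) or \<open>g\<close> vanishes off \<open>T\<close> (when \<open>|T| \<ge> n - k\<close>),
  then \<open>Q\<^bsub>|T|\<^esub>\<close> isolates \<open>c\<^sub>T\<close>. For \<open>g = \<Prod>\<^bsub>j \<in> K\<^esub> (\<alpha> - a\<^sub>j)\<close> and \<open>h = \<Prod>\<^bsub>j \<in> L\<^esub> (\<alpha> - a\<^sub>j)\<close>,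
  \<open>\<Sum>\<^sub>d Q\<^sub>d(g, h) z\<^sup>d\<close> is a nonzero multiple of the value in condition (2) at \<open>z \<noteq> 0\<close>.

  Conversely, the degree bounds leave at most \<open>n - k - l - 1\<close> consecutive powers of \<open>z\<close>, so the
  roots in \<open>Z\<close> force \<open>Q\<^sub>d(g, h) = 0\<close> for all such split \<open>g, h\<close>. Now \<open>Q\<^sub>d\<close> is homogeneous of degree
  \<open>d \<le> n - k\<close> in \<open>g\<close> and \<open>n - d \<le> n - l\<close> in \<open>h\<close>, and such a form is determined by its values on
  split polynomials with roots among the abscissas.
\<close>

section \<open>Vanishing criteria for univariate polynomials and for homogeneous functions of
  polynomials\<close>

lemma poly_eq_0_if_infinite_roots:
  fixes q :: "'b::field poly"
  assumes "finite B" "infinite (UNIV :: 'b set)" "\<And>t. t \<notin> B \<Longrightarrow> poly q t = 0"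
  shows "q = 0"
proof (rule ccontr)
  assume "q \<noteq> 0"
  then have "finite (B \<union> {t. poly q t = 0})"
    using assms(1) poly_roots_finite by blast
  moreover have "B \<union> {t. poly q t = 0} = UNIV"
    using assms(3) by auto
  ultimately show False
    using assms(2) by simp
qed

text \<open>Dividing \<open>q\<close> by the power of the variable with exponent
  \<open>l + 1\<close> keeps its nonzero roots and leaves degree at most \<open>m - l - 2\<close>,
  one less than the number of roots that \<open>Z\<close> supplies. The bound \<open>m\<close> is an
  integer because it will be \<open>n - k\<close>, which may be negative.\<close>

lemma poly_eq_0_if_nonzero_roots:
  fixes q :: "'a::field poly"
  assumes coeffs: "\<And>d. coeff q d \<noteq> 0 \<Longrightarrow> l < d \<and> int d < m"
    and "0 \<notin> Z" and roots: "\<And>z. z \<in> Z \<Longrightarrow> poly q z = 0"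
    and size: "finite Z \<longrightarrow> int (card Z) \<ge> m - int l - 1"
  shows "q = 0"
proof (rule ccontr)
  assume q0: "q \<noteq> 0"
  define r where "r = poly_shift (Suc l) q"
  have q: "q = monom 1 (Suc l) * r"
  proof (rule poly_eqI)
    fix d
    show "coeff q d = coeff (monom 1 (Suc l) * r) d"
      using coeffs[of d]
      by (cases "coeff q d = 0") (auto simp: coeff_monom_mult r_def coeff_poly_shift)
  qed
  then have r0: "r \<noteq> 0"
    using q0 by auto
  have "coeff q (Suc l + degree r) \<noteq> 0"
    using r0 by (subst q) (simp add: coeff_monom_mult)
  then have deg: "int (Suc l + degree r) < m"
    using coeffs by blast
  have sub: "Z \<subseteq> {z. poly r z = 0}"
    using roots q \<open>0 \<notin> Z\<close> by (auto simp: poly_monom)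
  then have "finite Z"
    using poly_roots_finite[OF r0] finite_subset by blast
  moreover have "card Z \<le> degree r"
    using card_mono[OF poly_roots_finite[OF r0] sub] card_poly_roots_bound[OF r0] by linarith
  ultimately show False
    using size deg by auto
qed

text \<open>A homogeneous polynomial function of degree \<open>d\<close> on the polynomials of degree at most
  \<open>k\<close> that vanishes on more than \<open>d\<close> of the hyperplanes \<open>poly g (b i) = 0\<close> vanishes; on such a
  hyperplane \<open>g\<close> has the factor \<open>[:- b i, 1:]\<close>, which reduces \<open>k\<close> by one.\<close>

lemma homogeneous_eq_0_if_vanishes_on_split:
  fixes F :: "'b::field poly \<Rightarrow> 'b" and b :: "nat \<Rightarrow> 'b"
  assumes inf: "infinite (UNIV :: 'b set)"
    and "\<And>g g'. \<exists>q. degree q \<le> d \<and> (\<forall>t. F (g + smult t g') = poly q t)"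
    and "\<And>t g. F (smult t g) = t ^ d * F g"
    and "finite I" "inj_on b I" "d + k \<le> card I"
    and "\<And>K. K \<subseteq> I \<Longrightarrow> card K = k \<Longrightarrow> F (\<Prod>j\<in>K. [:- b j, 1:]) = 0"
    and "degree g \<le> k"
  shows "F g = 0"
  using assms(2-)
proof (induction k arbitrary: F I g)
  case 0
  have "F 1 = 0"
    using "0.prems"(6)[of "{}"] by simp
  moreover have "g = smult (coeff g 0) 1"
    using "0.prems"(7) degree_0_id[of g] by (simp add: one_pCons)
  ultimately show ?case
    using "0.prems"(2)[of "coeff g 0" 1] by simp
next
  case (Suc k)
  have root: "F g = 0" if i: "i \<in> I" and g: "poly g (b i) = 0" "degree g \<le> Suc k" for i g
  proof -
    obtain g' where g': "g = [:- b i, 1:] * g'"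
      using g(1) by (auto simp: poly_eq_0_iff_dvd dvd_def)
    have deg: "degree g' \<le> k"
      using g(2) g' by (cases "g' = 0") (auto simp: degree_mult_eq simp del: mult_pCons_left)
    have "F ([:- b i, 1:] * g') = 0"
    \<comment> \<open>Passing to multiples of the linear factor and removing \<open>i\<close> from
      \<open>I\<close> lowers both \<open>k\<close> and \<open>card I\<close> by one, so the bound
      \<open>d + k \<le> card I\<close> survives. The degree \<open>d\<close> stays the
      same.\<close>
    proof (rule Suc.IH[of "\<lambda>g. F ([:- b i, 1:] * g)" "I - {i}" g', OF _ _ _ _ _ _ deg])
      show "\<exists>q. degree q \<le> d \<and> (\<forall>t. F ([:- b i, 1:] * (g + smult t g'')) = poly q t)" for g g''
        using Suc.prems(1)[of "[:- b i, 1:] * g" "[:- b i, 1:] * g''"]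
        by (simp only: distrib_left mult_smult_right)
      show "F ([:- b i, 1:] * smult t g) = t ^ d * F ([:- b i, 1:] * g)" for t g
        by (simp only: mult_smult_right Suc.prems(2))
      show "F ([:- b i, 1:] * (\<Prod>j\<in>K. [:- b j, 1:])) = 0" if K: "K \<subseteq> I - {i}" "card K = k" for K
      proof -
        have "finite K" "i \<notin> K"
          using K Suc.prems(3) finite_subset by blast+
        then show ?thesis
          using Suc.prems(6)[of "insert i K"] K i
          by (simp add: subset_iff del: mult_pCons_left)
      qed
    qed (use Suc.prems i in \<open>auto intro: inj_on_subset\<close>)
    then show ?thesis
      using g' by simp
  qed
  \<comment> \<open>On the line of translates of \<open>g\<close> by constants, \<open>F\<close> is
    a polynomial of degree at most \<open>d\<close>. The translate by \<open>- poly g (b i)\<close>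
    has the root \<open>b i\<close>. Separated values give \<open>card I \<ge> d + Suc k\<close>
    different such translates, more roots than the degree allows.\<close>
  have separated: "F g = 0" if g: "degree g \<le> Suc k" and inj: "inj_on (\<lambda>i. poly g (b i)) I" for g
  proof -
    obtain q where q: "degree q \<le> d" "\<And>t. F (g + smult t 1) = poly q t"
      using Suc.prems(1) by metis
    have "degree (g + smult t 1) \<le> Suc k" for t
      using g by (intro degree_add_le) auto
    then have "poly q (- poly g (b i)) = 0" if "i \<in> I" for i
      unfolding q(2)[symmetric] using that by (intro root) auto
    then have sub: "(\<lambda>i. - poly g (b i)) ` I \<subseteq> {t. poly q t = 0}"
      by auto
    have "card ((\<lambda>i. - poly g (b i)) ` I) = card I"
      using inj by (intro card_image) (auto simp: inj_on_def)
    then have "q = 0"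
      using card_mono[OF poly_roots_finite sub] card_poly_roots_bound[of q] q(1) Suc.prems(5)
      by fastforce
    then show ?thesis
      using q(2)[of 0] by simp
  qed
  \<comment> \<open>A general \<open>g\<close> is reduced to the separated case by adding multiples
    of the variable: two abscissas get the same value for only one multiplier, and \<open>B\<close>
    collects these finitely many bad multipliers. So \<open>F\<close> vanishes at almost all points
    of this line, hence also at \<open>t = 0\<close>.\<close>
  let ?x = "[:0, 1:] :: 'b poly"
  define B where "B = (\<lambda>(i, j). (poly g (b j) - poly g (b i)) / (b i - b j)) ` (I \<times> I)"
  obtain q where q: "\<And>t. F (g + smult t ?x) = poly q t"
    using Suc.prems(1) by metis
  have "q = 0"
  proof (rule poly_eq_0_if_infinite_roots[OF _ inf])
    show "finite B"
      using Suc.prems(3) by (simp add: B_def)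
    show "poly q t = 0" if t: "t \<notin> B" for t
      unfolding q[symmetric]
    proof (rule separated)
      show "degree (g + smult t ?x) \<le> Suc k"
        using Suc.prems(7) by (intro degree_add_le) auto
      show "inj_on (\<lambda>i. poly (g + smult t ?x) (b i)) I"
      proof (rule inj_onI, rule ccontr)
        fix i j
        assume ij: "i \<in> I" "j \<in> I" "i \<noteq> j"
          and eq: "poly (g + smult t ?x) (b i) = poly (g + smult t ?x) (b j)"
        have "b i - b j \<noteq> 0"
          using ij Suc.prems(4) by (auto simp: inj_on_def)
        moreover have "t * (b i - b j) = poly g (b j) - poly g (b i)"
          using eq by (simp add: algebra_simps)
        ultimately have "t = (poly g (b j) - poly g (b i)) / (b i - b j)"
          by (simp add: field_simps)
        then show False
          using t ij by (auto simp: B_def)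
      qed
    qed
  qed
  then show ?case
    using q[of 0] by simp
qed

section \<open>Homogeneous forms indexed by subsets, and their extension from split to arbitrary
  arguments\<close>

text \<open>This is \<open>Q\<^sub>d\<close> of the overview. Taking the families of values
  \<open>G\<close> and \<open>H\<close> as arguments, rather than polynomials, lets the form be
  mapped along ring homomorphisms and its two arguments be exchanged.\<close>

definition subset_form ::
    "nat set \<Rightarrow> (nat set \<Rightarrow> 'b::comm_ring_1) \<Rightarrow> nat \<Rightarrow> (nat \<Rightarrow> 'b) \<Rightarrow> (nat \<Rightarrow> 'b) \<Rightarrow> 'b" where
  "subset_form I c d G H =
     (\<Sum>S | S \<subseteq> I \<and> card S = d. c S * (\<Prod>i\<in>S. G i) * (\<Prod>i\<in>I - S. H i))"

text \<open>Complementing \<open>S\<close> exchanges the two products. This symmetry carries results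
  about the numerator over to the denominator.\<close>

lemma subset_form_swap:
  assumes "finite I" "d \<le> card I"
  shows "subset_form I c d G H = subset_form I (\<lambda>S. c (I - S)) (card I - d) H G"
  unfolding subset_form_def
proof (rule sum.reindex_bij_witness[of _ "\<lambda>S. I - S" "\<lambda>S. I - S"])
  fix S assume S: "S \<in> {S. S \<subseteq> I \<and> card S = d}"
  then have "I - (I - S) = S" by auto
  then show "I - (I - S) = S"
    and "c (I - (I - S)) * (\<Prod>i\<in>I - S. H i) * (\<Prod>i\<in>I - (I - S). G i) =
      c S * (\<Prod>i\<in>S. G i) * (\<Prod>i\<in>I - S. H i)"
    by (simp_all add: mult_ac)
  show "I - S \<in> {S. S \<subseteq> I \<and> card S = card I - d}"
    using S assms by (auto simp: card_Diff_subset finite_subset)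
next
  fix S assume S: "S \<in> {S. S \<subseteq> I \<and> card S = card I - d}"
  then show "I - (I - S) = S" by auto
  show "I - S \<in> {S. S \<subseteq> I \<and> card S = d}"
    using S assms by (auto simp: card_Diff_subset finite_subset)
qed

lemma subset_form_hom:
  assumes "comm_ring_hom_fun \<phi>"
  shows "\<phi> (subset_form I c d G H) = subset_form I (\<lambda>S. \<phi> (c S)) d (\<lambda>i. \<phi> (G i)) (\<lambda>i. \<phi> (H i))"
proof -
  have "\<phi> (x * y) = \<phi> x * \<phi> y" for x y
    using assms by (simp add: comm_ring_hom_fun_def)
  then show ?thesis
    by (simp add: subset_form_def hom_sum[OF assms] hom_prod[OF assms])
qed

lemma sum_Pow_by_card:
  fixes f :: "'i set \<Rightarrow> 'b::comm_monoid_add"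
  assumes "finite I"
  shows "(\<Sum>S\<in>Pow I. f S) = (\<Sum>d\<le>card I. \<Sum>S | S \<subseteq> I \<and> card S = d. f S)"
proof -
  have "(\<Sum>d\<le>card I. \<Sum>S\<in>{S \<in> Pow I. card S = d}. f S) = (\<Sum>S\<in>Pow I. f S)"
    using assms by (intro sum.group) (auto intro: card_mono)
  then show ?thesis
    by simp
qed

text \<open>With \<open>H\<close> fixed, the form is homogeneous of degree \<open>d\<close> in the
  values of \<open>g\<close>, so the criterion for homogeneous functions applies.\<close>

lemma subset_form_eq_0_numerator:
  fixes b :: "nat \<Rightarrow> 'b::field"
  assumes inf: "infinite (UNIV :: 'b set)"
    and I: "finite I" "inj_on b I" "d + k \<le> card I"
    and zero: "\<And>K. K \<subseteq> I \<Longrightarrow> card K = k \<Longrightarrow>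
      subset_form I c d (\<lambda>i. poly (\<Prod>j\<in>K. [:- b j, 1:]) (b i)) H = 0"
    and "degree g \<le> k"
  shows "subset_form I c d (\<lambda>i. poly g (b i)) H = 0"
proof (rule homogeneous_eq_0_if_vanishes_on_split
      [where F = "\<lambda>g. subset_form I c d (\<lambda>i. poly g (b i)) H",
        OF inf _ _ I _ \<open>degree g \<le> k\<close>])
  fix g g' :: "'b poly"
  \<comment> \<open>The restriction to the line through \<open>g\<close> in direction
    \<open>g'\<close>, with \<open>t\<close> as the polynomial variable: each factor of the product
    over \<open>S\<close> is linear in \<open>t\<close>.\<close>
  let ?q = "\<Sum>S | S \<subseteq> I \<and> card S = d.
    smult (c S * (\<Prod>i\<in>I - S. H i)) (\<Prod>i\<in>S. [:poly g (b i), poly g' (b i):])"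
  have "degree (\<Prod>i\<in>S. [:poly g (b i), poly g' (b i):]) \<le> d" if "S \<subseteq> I" "card S = d" for S
  proof -
    have "finite S"
      using that I finite_subset by blast
    then have "degree (\<Prod>i\<in>S. [:poly g (b i), poly g' (b i):]) \<le>
      (\<Sum>i\<in>S. degree [:poly g (b i), poly g' (b i):])"
      using degree_prod_sum_le[of S "\<lambda>i. [:poly g (b i), poly g' (b i):]"] by (simp add: o_def)
    also have "\<dots> \<le> (\<Sum>i\<in>S. 1)"
      by (intro sum_mono) simp
    finally show ?thesis
      using that by simp
  qed
  then have "degree ?q \<le> d"
    using I by (intro degree_sum_le) (auto intro: order_trans[OF degree_smult_le])
  moreover have "subset_form I c d (\<lambda>i. poly (g + smult t g') (b i)) H = poly ?q t" for t
    by (simp add: subset_form_def poly_sum poly_prod mult_ac)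
  ultimately show "\<exists>q. degree q \<le> d \<and>
      (\<forall>t. subset_form I c d (\<lambda>i. poly (g + smult t g') (b i)) H = poly q t)"
    by blast
next
  fix t :: 'b and g :: "'b poly"
  show "subset_form I c d (\<lambda>i. poly (smult t g) (b i)) H =
      t ^ d * subset_form I c d (\<lambda>i. poly g (b i)) H"
    unfolding subset_form_def sum_distrib_left
    by (rule sum.cong) (auto simp: prod.distrib mult_ac)
qed (use zero in auto)

text \<open>The extension is done one argument at a time: first from split to arbitrary numerators
  with a split denominator, then to arbitrary denominators through \<open>swap\<close>. The two
  degrees \<open>d\<close> and \<open>card I - d\<close> account for the two size
  hypotheses.\<close>

lemma subset_form_eq_0:
  fixes b :: "nat \<Rightarrow> 'b::field"
  assumes inf: "infinite (UNIV :: 'b set)"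
    and I: "finite I" "inj_on b I" and "d + k \<le> card I" "l \<le> d"
    and zero: "\<And>K L. K \<subseteq> I \<Longrightarrow> L \<subseteq> I \<Longrightarrow> K \<inter> L = {} \<Longrightarrow> card K = k \<Longrightarrow> card L = l \<Longrightarrow>
      subset_form I c d (\<lambda>i. \<Prod>j\<in>K. b i - b j) (\<lambda>i. \<Prod>j\<in>L. b i - b j) = 0"
    and "degree g \<le> k" "degree h \<le> l"
  shows "subset_form I c d (\<lambda>i. poly g (b i)) (\<lambda>i. poly h (b i)) = 0"
proof -
  have swap: "subset_form I c d G H = subset_form I (\<lambda>S. c (I - S)) (card I - d) H G" for G H
    using assms by (intro subset_form_swap) auto
  have KL: "subset_form I c d (\<lambda>i. poly (\<Prod>j\<in>K. [:- b j, 1:]) (b i))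
      (\<lambda>i. poly (\<Prod>j\<in>L. [:- b j, 1:]) (b i)) = 0"
    if KL: "K \<subseteq> I" "card K = k" "L \<subseteq> I" "card L = l" for K L
  proof (cases "K \<inter> L = {}")
    case True
    then show ?thesis
      using zero[of K L] KL by (simp add: poly_prod)
  next
    \<comment> \<open>Overlapping \<open>K\<close> and \<open>L\<close> cause no trouble: for a
      common index \<open>j\<close>, each \<open>S\<close> either contains \<open>j\<close>, which
      kills the numerator product, or omits it, which kills the denominator product.\<close>
    case False
    then obtain j where j: "j \<in> K" "j \<in> L" by auto
    have fin: "finite K" "finite L" "finite S" if "S \<subseteq> I" for S
      using KL that I finite_subset by blast+
    show ?thesis
      unfolding subset_form_def
    proof (rule sum.neutral, rule ballI)
      fix S assume "S \<in> {S. S \<subseteq> I \<and> card S = d}"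
      then have "S \<subseteq> I" by simp
      show "c S * (\<Prod>i\<in>S. poly (\<Prod>j\<in>K. [:- b j, 1:]) (b i)) *
          (\<Prod>i\<in>I - S. poly (\<Prod>j\<in>L. [:- b j, 1:]) (b i)) = 0"
        using j KL fin[OF \<open>S \<subseteq> I\<close>] I
        by (cases "j \<in> S") (auto simp: poly_prod prod_zero_iff)
    qed
  qed
  have gL: "subset_form I c d (\<lambda>i. poly g (b i)) (\<lambda>i. poly (\<Prod>j\<in>L. [:- b j, 1:]) (b i)) = 0"
    if "L \<subseteq> I" "card L = l" for L
    by (rule subset_form_eq_0_numerator[OF inf I \<open>d + k \<le> card I\<close> _ \<open>degree g \<le> k\<close>])
      (use KL that in blast)
  have "card I - d + l \<le> card I"
    using assms by simp
  then show ?thesis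
    unfolding swap
    by (rule subset_form_eq_0_numerator[OF inf I _ _ \<open>degree h \<le> l\<close>])
      (use gL swap in metis)
qed

section \<open>Multilinear polynomials as sums over subsets\<close>

definition squarefree_monomial :: "nat set \<Rightarrow> monomial" where
  "squarefree_monomial S = (\<Sum>i\<in>S. Poly_Mapping.single i 1)"

lemma lookup_squarefree_monomial:
  "finite S \<Longrightarrow> Poly_Mapping.lookup (squarefree_monomial S) i = (if i \<in> S then 1 else 0)"
  by (simp add: squarefree_monomial_def lookup_sum lookup_single when_def)

lemma keys_squarefree_monomial: "finite S \<Longrightarrow> Poly_Mapping.keys (squarefree_monomial S) = S"
  by (auto simp: in_keys_iff lookup_squarefree_monomial split: if_splits)

lemma monomial_degree_squarefree_monomial:
  "finite S \<Longrightarrow> monomial_degree (squarefree_monomial S) = card S"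
  by (simp add: monomial_degree_def keys_squarefree_monomial lookup_squarefree_monomial)

lemma multilinear_keyE:
  assumes "multilinear p" "p \<in> mpolys n" "m \<in> Poly_Mapping.keys p"
  obtains S where "S \<subseteq> {1..n}" "m = squarefree_monomial S"
proof
  show "Poly_Mapping.keys m \<subseteq> {1..n}"
    using assms by (auto simp: mpolys_def)
  show "m = squarefree_monomial (Poly_Mapping.keys m)"
  proof (rule poly_mapping_eqI)
    fix i
    have "Poly_Mapping.lookup m i \<le> 1"
      using assms by (auto simp: multilinear_def)
    then show "Poly_Mapping.lookup m i =
        Poly_Mapping.lookup (squarefree_monomial (Poly_Mapping.keys m)) i"
      by (auto simp: lookup_squarefree_monomial in_keys_iff)
  qed
qed

lemma multilinear_expansion:
  assumes "multilinear p" "p \<in> mpolys n"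
  shows "p = (\<Sum>S\<in>Pow {1..n}. Poly_Mapping.single (squarefree_monomial S)
    (Poly_Mapping.lookup p (squarefree_monomial S)))"
proof -
  have inj: "inj_on squarefree_monomial (Pow {1..n})"
    by (rule inj_on_inverseI[where g = Poly_Mapping.keys])
      (metis PowD finite_atLeastAtMost finite_subset keys_squarefree_monomial)
  have "p = (\<Sum>m\<in>Poly_Mapping.keys p. Poly_Mapping.single m (Poly_Mapping.lookup p m))"
    by (simp add: sum_single_keys)
  also have "\<dots> = (\<Sum>m\<in>squarefree_monomial ` Pow {1..n}.
      Poly_Mapping.single m (Poly_Mapping.lookup p m))"
    by (rule sum.mono_neutral_left) (auto simp: in_keys_iff elim!: multilinear_keyE[OF assms])
  finally show ?thesis
    by (simp only: sum.reindex[OF inj] o_def)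
qed

lemma mpoly_eval_squarefree:
  assumes "comm_ring_hom_fun \<phi>" "finite S"
  shows "mpoly_eval \<phi> x (Poly_Mapping.single (squarefree_monomial S) c) = \<phi> c * (\<Prod>i\<in>S. x i)"
  using assms by (simp add: mpoly_eval_single keys_squarefree_monomial lookup_squarefree_monomial)

lemma mpoly_eval_multilinear:
  assumes "comm_ring_hom_fun \<phi>" "multilinear p" "p \<in> mpolys n"
  shows "mpoly_eval \<phi> x p =
    (\<Sum>S\<in>Pow {1..n}. \<phi> (Poly_Mapping.lookup p (squarefree_monomial S)) * (\<Prod>i\<in>S. x i))"
proof -
  have "mpoly_eval \<phi> x p = (\<Sum>S\<in>Pow {1..n}. mpoly_eval \<phi> x (Poly_Mapping.single
      (squarefree_monomial S) (Poly_Mapping.lookup p (squarefree_monomial S))))"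
    by (subst multilinear_expansion[OF assms(2,3)]) (rule mpoly_eval_sum[OF assms(1)])
  also have "\<dots> = (\<Sum>S\<in>Pow {1..n}.
      \<phi> (Poly_Mapping.lookup p (squarefree_monomial S)) * (\<Prod>i\<in>S. x i))"
    by (intro sum.cong refl mpoly_eval_squarefree[OF assms(1)]) (auto intro: finite_subset)
  finally show ?thesis .
qed

section \<open>Partial derivatives, substitution of zero, and condition (2) in terms of subset
  forms\<close>

lemma mpoly_pderiv_superset:
  assumes "finite A" "Poly_Mapping.keys p \<subseteq> A"
  shows "mpoly_pderiv j p = (\<Sum>m\<in>A. Poly_Mapping.single (m - Poly_Mapping.single j 1)
    (of_nat (Poly_Mapping.lookup m j) * Poly_Mapping.lookup p m))"
  unfolding mpoly_pderiv_def
  by (rule sum.mono_neutral_left) (use assms in \<open>auto simp: in_keys_iff\<close>)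

lemma mpoly_pderiv_add: "mpoly_pderiv j (p + q) = mpoly_pderiv j p + mpoly_pderiv j q"
proof -
  let ?A = "Poly_Mapping.keys p \<union> Poly_Mapping.keys q"
  have "Poly_Mapping.keys (p + q) \<subseteq> ?A" by (rule Poly_Mapping.keys_add)
  then show ?thesis
    by (simp add: mpoly_pderiv_superset[of ?A] lookup_add distrib_left single_add sum.distrib)
qed

lemma mpoly_pderiv_sum: "mpoly_pderiv j (sum f A) = (\<Sum>i\<in>A. mpoly_pderiv j (f i))"
  by (induction A rule: infinite_finite_induct)
    (simp_all add: mpoly_pderiv_add, simp_all add: mpoly_pderiv_def)

lemma mpoly_pderiv_squarefree:
  assumes "finite S"
  shows "mpoly_pderiv j (Poly_Mapping.single (squarefree_monomial S) c) =
    (if j \<in> S then Poly_Mapping.single (squarefree_monomial (S - {j})) c else 0)"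
proof -
  have "squarefree_monomial S - Poly_Mapping.single j 1 = squarefree_monomial (S - {j})"
    using assms by (intro poly_mapping_eqI)
      (auto simp: lookup_minus lookup_squarefree_monomial lookup_single when_def)
  then show ?thesis
    using assms by (subst mpoly_pderiv_superset[of "{squarefree_monomial S}"])
      (auto simp: lookup_squarefree_monomial split: if_splits)
qed

lemma fold_mpoly_pderiv_squarefree:
  assumes "distinct js" "finite \<S>" "\<And>S. S \<in> \<S> \<Longrightarrow> finite S"
  shows "fold mpoly_pderiv js (\<Sum>S\<in>\<S>. Poly_Mapping.single (squarefree_monomial S) (c S)) =
    (\<Sum>S\<in>\<S>. if set js \<subseteq> S then Poly_Mapping.single (squarefree_monomial (S - set js)) (c S) else 0)"
  using assms(1)
\<comment> \<open>\<open>fold\<close> differentiates by the last list element last, so peeling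
  elements off the end exposes the outermost derivative.\<close>
proof (induction js rule: rev_induct)
  case Nil
  then show ?case by simp
next
  case (snoc j js)
  have "mpoly_pderiv j (if set js \<subseteq> S
      then Poly_Mapping.single (squarefree_monomial (S - set js)) (c S) else 0) =
    (if set (js @ [j]) \<subseteq> S
      then Poly_Mapping.single (squarefree_monomial (S - set (js @ [j]))) (c S) else 0)"
    if "S \<in> \<S>" for S
  proof -
    have "S - set js - {j} = S - set (js @ [j])" by auto
    moreover have "mpoly_pderiv j 0 = (0 :: 'a mpoly)"
      by (simp add: mpoly_pderiv_def)
    ultimately show ?thesis
      using snoc.prems assms(3)[OF that] by (auto simp: mpoly_pderiv_squarefree)
  qed
  then show ?case
    using snoc by (simp add: mpoly_pderiv_sum cong: sum.cong)
qed

lemma hom_mconst: "comm_ring_hom_fun (mconst :: 'a::comm_ring_1 \<Rightarrow> 'a mpoly)"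
  by (simp add: comm_ring_hom_fun_def mconst_def single_add mult_single)

lemma mpoly_eval_set_zero:
  fixes p :: "'a::comm_ring_1 mpoly"
  shows "mpoly_eval (\<lambda>c. c) x (mpoly_set_zero K p) =
    mpoly_eval (\<lambda>c. c) (\<lambda>i. if i \<in> K then 0 else x i) p"
proof -
  have hid: "comm_ring_hom_fun (\<lambda>c::'a. c)" by (simp add: comm_ring_hom_fun_def)
  note hev = hom_mpoly_eval[OF hid, of x]
  have "mpoly_eval (\<lambda>c. c) x (if i \<in> K then 0 else mvar i) = (if i \<in> K then 0 else x i)" for i
    by (simp add: mpoly_eval_mvar[OF hid] mpoly_eval_0)
  then show ?thesis
    unfolding mpoly_set_zero_def
    by (simp add: mpoly_eval_def[of mconst] hom_sum[OF hev] mpoly_eval_mult[OF hid]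
        hom_prod[OF hev] hom_power[OF hev] mpoly_eval_mconst[OF hid])
      (simp add: mpoly_eval_def)
qed

text \<open>Differentiating by all of \<open>L\<close> keeps exactly the monomials divisible by
  every variable of \<open>L\<close> and strips these variables; setting \<open>K\<close> to zero
  then discards the monomials meeting \<open>K\<close>.\<close>

lemma mpoly_eval_set_zero_pderivs:
  fixes p :: "'a::comm_ring_1 mpoly"
  assumes "multilinear p" "p \<in> mpolys n" "finite L" "K \<inter> L = {}"
  shows "mpoly_eval (\<lambda>c. c) x (mpoly_set_zero K (mpoly_pderivs L p)) =
    (\<Sum>S | S \<subseteq> {1..n} \<and> L \<subseteq> S \<and> S \<inter> K = {}.
       Poly_Mapping.lookup p (squarefree_monomial S) * (\<Prod>i\<in>S - L. x i))"
proof -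
  define c where "c S = Poly_Mapping.lookup p (squarefree_monomial S)" for S
  define y where "y i = (if i \<in> K then 0 else x i)" for i
  have hid: "comm_ring_hom_fun (\<lambda>c::'a. c)" by (simp add: comm_ring_hom_fun_def)
  have fin: "finite S" if "S \<in> Pow {1..n}" for S
    using that finite_subset by auto
  have p: "p = (\<Sum>S\<in>Pow {1..n}. Poly_Mapping.single (squarefree_monomial S) (c S))"
    unfolding c_def by (rule multilinear_expansion[OF assms(1,2)])
  have "mpoly_pderivs L p = (\<Sum>S\<in>Pow {1..n}.
      if L \<subseteq> S then Poly_Mapping.single (squarefree_monomial (S - L)) (c S) else 0)"
    unfolding mpoly_pderivs_def
    by (subst p, subst fold_mpoly_pderiv_squarefree) (use fin assms in \<open>auto cong: if_cong\<close>)
  then have "mpoly_eval (\<lambda>c. c) x (mpoly_set_zero K (mpoly_pderivs L p)) =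
    (\<Sum>S\<in>Pow {1..n}. if L \<subseteq> S then c S * (\<Prod>i\<in>S - L. y i) else 0)"
    unfolding mpoly_eval_set_zero y_def[symmetric]
    by (auto simp: mpoly_eval_sum[OF hid] mpoly_eval_squarefree[OF hid] mpoly_eval_0 fin
        intro!: sum.cong)
  also have "\<dots> = (\<Sum>S | S \<subseteq> {1..n} \<and> L \<subseteq> S \<and> S \<inter> K = {}. c S * (\<Prod>i\<in>S - L. x i))"
  proof (rule sum.mono_neutral_cong_right)
    show "\<forall>S\<in>Pow {1..n} - {S. S \<subseteq> {1..n} \<and> L \<subseteq> S \<and> S \<inter> K = {}}.
        (if L \<subseteq> S then c S * (\<Prod>i\<in>S - L. y i) else 0) = 0"
    proof
      fix S assume S: "S \<in> Pow {1..n} - {S. S \<subseteq> {1..n} \<and> L \<subseteq> S \<and> S \<inter> K = {}}"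
      have "(\<Prod>i\<in>S - L. y i) = 0" if LS: "L \<subseteq> S"
      proof -
        \<comment> \<open>Since \<open>K\<close> and \<open>L\<close> are disjoint, \<open>j\<close>
          is not in \<open>L\<close>, so its zero factor remains in the product over
          \<open>S - L\<close>.\<close>
        obtain j where "j \<in> S" "j \<in> K" using S LS by blast
        then show ?thesis
          using S fin assms(4) by (intro prod_zero) (auto simp: y_def intro!: bexI[of _ j])
      qed
      then show "(if L \<subseteq> S then c S * (\<Prod>i\<in>S - L. y i) else 0) = 0" by simp
    qed
    show "(if L \<subseteq> S then c S * (\<Prod>i\<in>S - L. y i) else 0) = c S * (\<Prod>i\<in>S - L. x i)"
      if "S \<in> {S. S \<subseteq> {1..n} \<and> L \<subseteq> S \<and> S \<inter> K = {}}" for S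
    proof -
      have "(\<Prod>i\<in>S - L. y i) = (\<Prod>i\<in>S - L. x i)"
        using that by (intro prod.cong) (auto simp: y_def)
      then show ?thesis using that by simp
    qed
  qed auto
  finally show ?thesis by (simp add: c_def)
qed

text \<open>The zeros of \<open>G\<close> on \<open>K\<close> and of \<open>H\<close> on
  \<open>L\<close> kill every term except those with \<open>S\<close> disjoint from \<open>K\<close>
  and containing \<open>L\<close>. In a surviving term, pulling out the \<open>G\<close> factors on
  \<open>L\<close> and all \<open>H\<close> factors off \<open>L\<close> leaves the quotients
  \<open>G i / H i\<close> on \<open>S - L\<close>. The right-hand sum is the value in condition
  (2).\<close>

lemma scaled_sum_subset_form:
  fixes c :: "nat set \<Rightarrow> 'a::field"
  assumes I: "finite I" "L \<subseteq> I" "K \<inter> L = {}"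
    and G: "\<And>i. i \<in> K \<Longrightarrow> G i = 0"
    and H: "\<And>i. i \<in> L \<Longrightarrow> H i = 0" "\<And>i. i \<in> I - L \<Longrightarrow> H i \<noteq> 0"
  shows "(\<Sum>d\<le>card I. subset_form I c d G H * z ^ d) =
    z ^ card L * (\<Prod>i\<in>L. G i) * (\<Prod>i\<in>I - L. H i) *
    (\<Sum>S | S \<subseteq> I \<and> L \<subseteq> S \<and> S \<inter> K = {}. c S * (\<Prod>i\<in>S - L. z * (G i / H i)))"
proof -
  have "(\<Sum>d\<le>card I. subset_form I c d G H * z ^ d) =
      (\<Sum>S\<in>Pow I. c S * (\<Prod>i\<in>S. G i) * (\<Prod>i\<in>I - S. H i) * z ^ card S)"
    unfolding sum_Pow_by_card[OF I(1)] subset_form_def sum_distrib_right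
    by (intro sum.cong refl) auto
  also have "\<dots> = (\<Sum>S | S \<subseteq> I \<and> L \<subseteq> S \<and> S \<inter> K = {}.
      z ^ card L * (\<Prod>i\<in>L. G i) * (\<Prod>i\<in>I - L. H i) * (c S * (\<Prod>i\<in>S - L. z * (G i / H i))))"
  proof (rule sum.mono_neutral_cong_right)
    show "\<forall>S\<in>Pow I - {S. S \<subseteq> I \<and> L \<subseteq> S \<and> S \<inter> K = {}}.
        c S * (\<Prod>i\<in>S. G i) * (\<Prod>i\<in>I - S. H i) * z ^ card S = 0"
    proof
      fix S assume S: "S \<in> Pow I - {S. S \<subseteq> I \<and> L \<subseteq> S \<and> S \<inter> K = {}}"
      then have "finite S" using I finite_subset by auto
      moreover have "(\<exists>i\<in>S. G i = 0) \<or> (\<exists>i\<in>I - S. H i = 0)"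
        using S I(2) G H(1) by blast
      ultimately have "(\<Prod>i\<in>S. G i) = 0 \<or> (\<Prod>i\<in>I - S. H i) = 0"
        using I(1) by (auto simp: prod_zero_iff)
      then show "c S * (\<Prod>i\<in>S. G i) * (\<Prod>i\<in>I - S. H i) * z ^ card S = 0" by auto
    qed
    fix S assume S: "S \<in> {S. S \<subseteq> I \<and> L \<subseteq> S \<and> S \<inter> K = {}}"
    have fin: "finite S" "finite L" using S I finite_subset by auto
    have "(\<Prod>i\<in>S. G i) = (\<Prod>i\<in>L. G i) * (\<Prod>i\<in>S - L. G i)"
      using prod.subset_diff[of L S G] S fin by (simp add: mult.commute)
    moreover have "(\<Prod>i\<in>I - L. H i) = (\<Prod>i\<in>S - L. H i) * (\<Prod>i\<in>I - S. H i)"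
    proof -
      have "I - L - (S - L) = I - S" using S by auto
      then show ?thesis
        using prod.subset_diff[of "S - L" "I - L" H] S I by (auto simp: mult.commute)
    qed
    moreover have "(\<Prod>i\<in>S - L. z * (G i / H i)) * (\<Prod>i\<in>S - L. H i) =
        z ^ card (S - L) * (\<Prod>i\<in>S - L. G i)"
    proof -
      have "(\<Prod>i\<in>S - L. H i) \<noteq> 0"
        using H(2) S fin by (auto simp: prod_zero_iff)
      then show ?thesis
        by (simp add: prod.distrib prod_dividef)
    qed
    moreover have "z ^ card S = z ^ card L * z ^ card (S - L)"
      using S fin by (simp add: card_Diff_subset card_mono flip: power_add)
    ultimately show "c S * (\<Prod>i\<in>S. G i) * (\<Prod>i\<in>I - S. H i) * z ^ card S =
        z ^ card L * (\<Prod>i\<in>L. G i) * (\<Prod>i\<in>I - L. H i) * (c S * (\<Prod>i\<in>S - L. z * (G i / H i)))"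
      by (simp add: mult_ac)
  qed (use I in auto)
  finally show ?thesis
    by (simp add: sum_distrib_left)
qed

section \<open>The generic seed and the forms it makes vanish\<close>

lemma poly_rfe_num:
  "poly (rfe_num k) (to_fract (mconst x)) =
     to_fract (\<Sum>j\<le>k. mvar j * mconst x ^ j :: 'a::field mpoly)"
  by (simp add: rfe_num_def poly_sum poly_monom hom_sum[OF hom_to_fract]
      hom_power[OF hom_to_fract])

lemma poly_rfe_den:
  "poly (rfe_den k l) (to_fract (mconst x)) =
     to_fract (\<Sum>j\<le>l. mvar (k + 1 + j) * mconst x ^ j :: 'a::field mpoly)"
  by (simp add: rfe_den_def poly_sum poly_monom hom_sum[OF hom_to_fract]
      hom_power[OF hom_to_fract])

lemma poly_rfe_den_nonzero: "poly (rfe_den k l) (to_fract (mconst (x :: 'a::field))) \<noteq> 0"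
proof
  have hid: "comm_ring_hom_fun (\<lambda>c::'a. c)" by (simp add: comm_ring_hom_fun_def)
  \<comment> \<open>This specialisation turns the generic denominator into the constant polynomial
    1: the indeterminate \<open>k + 1\<close> is its constant coefficient.\<close>
  let ?ev = "mpoly_eval (\<lambda>c::'a. c) (\<lambda>j. if j = k + 1 then 1 else 0)"
  assume "poly (rfe_den k l) (to_fract (mconst x)) = 0"
  then have "?ev (\<Sum>j\<le>l. mvar (k + 1 + j) * mconst x ^ j) = 0"
    by (simp only: poly_rfe_den to_fract_eq_0_iff mpoly_eval_0)
  then have "(\<Sum>j\<le>l. if j = 0 then (1::'a) else 0) = 0"
    by (simp add: mpoly_eval_sum[OF hid] mpoly_eval_mult[OF hid] mpoly_eval_mvar[OF hid]
        hom_power[OF hom_mpoly_eval[OF hid]] mpoly_eval_mconst[OF hid]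
        if_distrib[of "\<lambda>y. y * _"] cong: if_cong)
  then show False by simp
qed

text \<open>Each variable occurs to at most the first power, so multiplying by the product of all
  denominator values, one per index, clears the denominators; that product is nonzero.\<close>

lemma rfe_vanishing_ideal_iff_sum_eq_0:
  fixes p :: "'a::field mpoly"
  assumes "multilinear p" "p \<in> mpolys n"
  shows "p \<in> rfe_vanishing_ideal n a k l \<longleftrightarrow>
    (\<Sum>S\<in>Pow {1..n}. to_fract (mconst (Poly_Mapping.lookup p (squarefree_monomial S))) *
       (\<Prod>i\<in>S. poly (rfe_num k) (to_fract (mconst (a i)))) *
       (\<Prod>i\<in>{1..n} - S. poly (rfe_den k l) (to_fract (mconst (a i))))) = 0"
proof -
  define G where "G i = poly (rfe_num k) (to_fract (mconst (a i)))" for i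
  define H where "H i = poly (rfe_den k l) (to_fract (mconst (a i)))" for i
  define c where "c S = to_fract (mconst (Poly_Mapping.lookup p (squarefree_monomial S)))" for S
  have H0: "H i \<noteq> 0" for i
    unfolding H_def by (rule poly_rfe_den_nonzero)
  have hom: "comm_ring_hom_fun (\<lambda>c::'a. to_fract (mconst c))"
    using hom_mconst[where 'a = 'a] by (simp add: comm_ring_hom_fun_def)
  have "mpoly_eval (\<lambda>c. to_fract (mconst c)) (rfe_value a k l) p * (\<Prod>i\<in>{1..n}. H i) =
      (\<Sum>S\<in>Pow {1..n}. c S * (\<Prod>i\<in>S. G i / H i) * (\<Prod>i\<in>{1..n}. H i))"
    by (simp add: mpoly_eval_multilinear[OF hom assms] rfe_value_def G_def H_def c_def
        sum_distrib_right)
  also have "\<dots> = (\<Sum>S\<in>Pow {1..n}. c S * (\<Prod>i\<in>S. G i) * (\<Prod>i\<in>{1..n} - S. H i))"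
  proof (rule sum.cong[OF refl])
    fix S assume S: "S \<in> Pow {1..n}"
    then have "(\<Prod>i\<in>{1..n}. H i) = (\<Prod>i\<in>S. H i) * (\<Prod>i\<in>{1..n} - S. H i)"
      using prod.subset_diff[of S "{1..n}" H] by (simp add: mult.commute)
    moreover have "(\<Prod>i\<in>S. G i / H i) * (\<Prod>i\<in>S. H i) = (\<Prod>i\<in>S. G i)"
      by (simp add: H0 flip: prod.distrib)
    ultimately show "c S * (\<Prod>i\<in>S. G i / H i) * (\<Prod>i\<in>{1..n}. H i) =
        c S * (\<Prod>i\<in>S. G i) * (\<Prod>i\<in>{1..n} - S. H i)"
      by (simp add: mult.assoc[symmetric])
  qed
  finally have eq: "mpoly_eval (\<lambda>c. to_fract (mconst c)) (rfe_value a k l) p * (\<Prod>i\<in>{1..n}. H i) =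
      (\<Sum>S\<in>Pow {1..n}. c S * (\<Prod>i\<in>S. G i) * (\<Prod>i\<in>{1..n} - S. H i))" .
  have "(\<Prod>i\<in>{1..n}. H i) \<noteq> 0"
    using H0 by simp
  then have "mpoly_eval (\<lambda>c. to_fract (mconst c)) (rfe_value a k l) p = 0 \<longleftrightarrow>
      (\<Sum>S\<in>Pow {1..n}. c S * (\<Prod>i\<in>S. G i) * (\<Prod>i\<in>{1..n} - S. H i)) = 0"
    unfolding eq[symmetric] by simp
  then show ?thesis
    using assms(2) by (simp add: rfe_vanishing_ideal_def G_def H_def c_def)
qed

text \<open>Specialising the numerator of the generic seed to \<open>z g\<close> with \<open>z\<close> a fresh indeterminate
  separates the homogeneous components of \<open>p\<close>.\<close>

lemma rfe_vanishing_ideal_imp_subset_form_eq_0: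
  fixes p :: "'a::field mpoly"
  assumes "multilinear p" "p \<in> mpolys n" "p \<in> rfe_vanishing_ideal n a k l"
    and "degree g \<le> k" "degree h \<le> l"
  shows "subset_form {1..n} (\<lambda>S. Poly_Mapping.lookup p (squarefree_monomial S)) d
    (\<lambda>i. poly g (a i)) (\<lambda>i. poly h (a i)) = 0"
proof -
  define c where "c S = Poly_Mapping.lookup p (squarefree_monomial S)" for S
  define G :: "nat \<Rightarrow> 'a mpoly" where "G i = (\<Sum>j\<le>k. mvar j * mconst (a i) ^ j)" for i
  define H :: "nat \<Rightarrow> 'a mpoly" where "H i = (\<Sum>j\<le>l. mvar (k + 1 + j) * mconst (a i) ^ j)" for i
  \<comment> \<open>The fresh indeterminate is \<open>monom 1 1\<close>; it multiplies only the
    numerator coefficients. The shift by \<open>k + 1\<close> undoes the numbering of the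
    denominator indeterminates.\<close>
  define u where "u j = (if j \<le> k then monom 1 1 * [:coeff g j:] else [:coeff h (j - (k + 1)):])" for j
  define \<psi> where "\<psi> = mpoly_eval (\<lambda>c::'a. [:c:]) u"
  have hC: "comm_ring_hom_fun (\<lambda>c::'a. [:c:])"
    by (simp add: comm_ring_hom_fun_def)
  note h\<psi> = hom_mpoly_eval[OF hC, of u, folded \<psi>_def]
  have \<psi>m: "\<psi> (x * y) = \<psi> x * \<psi> y" for x y
    using h\<psi> by (simp add: comm_ring_hom_fun_def)
  have \<psi>0: "\<psi> 0 = 0"
    using h\<psi> by (simp add: comm_ring_hom_fun_def)
  have \<psi>c: "\<psi> (mconst x) = [:x:]" and \<psi>v: "\<psi> (mvar j) = u j" for x j
    by (simp_all add: \<psi>_def mpoly_eval_mconst[OF hC] mpoly_eval_mvar[OF hC])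
  have sum_coeff: "(\<Sum>j\<le>m. coeff f j * x ^ j) = poly f x" if "degree f \<le> m" for f :: "'a poly" and m x
    using arg_cong[OF poly_as_sum_of_monoms'[OF that], of "\<lambda>f. poly f x"]
    by (simp add: poly_sum poly_monom)
  have pC: "[:x:] * [:y:] = [:x * y:]" for x y :: 'a by simp
  have \<psi>G: "\<psi> (G i) = monom 1 1 * [:poly g (a i):]" for i
  proof -
    have "\<psi> (G i) = (\<Sum>j\<le>k. monom 1 1 * [:coeff g j * a i ^ j:])"
      unfolding G_def hom_sum[OF h\<psi>]
      by (rule sum.cong)
        (simp_all only: \<psi>m \<psi>v \<psi>c hom_power[OF h\<psi>] hom_power[OF hC, symmetric] u_def mult.assoc pC
          atMost_iff if_True)
    also have "\<dots> = monom 1 1 * [:poly g (a i):]"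
      by (simp only: sum_distrib_left[symmetric] hom_sum[OF hC, symmetric] sum_coeff[OF assms(4)])
    finally show ?thesis .
  qed
  have \<psi>H: "\<psi> (H i) = [:poly h (a i):]" for i
  proof -
    have "u (k + 1 + j) = [:coeff h j:]" for j
      by (simp add: u_def)
    then have "\<psi> (H i) = (\<Sum>j\<le>l. [:coeff h j * a i ^ j:])"
      unfolding H_def hom_sum[OF h\<psi>]
      by (simp only: \<psi>m \<psi>v \<psi>c hom_power[OF h\<psi>] hom_power[OF hC, symmetric] pC)
    also have "\<dots> = [:poly h (a i):]"
      by (simp only: hom_sum[OF hC, symmetric] sum_coeff[OF assms(5)])
    finally show ?thesis .
  qed
  \<comment> \<open>The cleared identity already holds between polynomials, so \<open>\<psi>\<close>
    can be applied without specialising any denominator.\<close>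
  have "to_fract (\<Sum>S\<in>Pow {1..n}. mconst (c S) * (\<Prod>i\<in>S. G i) * (\<Prod>i\<in>{1..n} - S. H i)) = 0"
    using assms(3)
    unfolding rfe_vanishing_ideal_iff_sum_eq_0[OF assms(1,2)] poly_rfe_num poly_rfe_den
      G_def[symmetric] H_def[symmetric] c_def[symmetric]
    by (simp add: hom_sum[OF hom_to_fract] hom_prod[OF hom_to_fract])
  then have "0 = \<psi> (\<Sum>S\<in>Pow {1..n}. mconst (c S) * (\<Prod>i\<in>S. G i) * (\<Prod>i\<in>{1..n} - S. H i))"
    using \<psi>0 by (simp only: to_fract_eq_0_iff)
  also have "\<dots> = (\<Sum>S\<in>Pow {1..n}. monom
      (c S * (\<Prod>i\<in>S. poly g (a i)) * (\<Prod>i\<in>{1..n} - S. poly h (a i))) (card S))"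
    unfolding hom_sum[OF h\<psi>]
  proof (rule sum.cong[OF refl])
    fix S assume "S \<in> Pow {1..n}"
    have "\<psi> (mconst (c S) * (\<Prod>i\<in>S. G i) * (\<Prod>i\<in>{1..n} - S. H i)) =
        [:c S:] * (monom 1 1 ^ card S * [:\<Prod>i\<in>S. poly g (a i):]) *
          [:\<Prod>i\<in>{1..n} - S. poly h (a i):]"
      by (simp only: \<psi>m \<psi>c hom_prod[OF h\<psi>] \<psi>G \<psi>H prod.distrib prod_constant
          hom_prod[OF hC, symmetric])
    also have "\<dots> = monom (c S * (\<Prod>i\<in>S. poly g (a i)) * (\<Prod>i\<in>{1..n} - S. poly h (a i))) (card S)"
      by (simp add: monom_power smult_monom mult_ac)
    finally show "\<psi> (mconst (c S) * (\<Prod>i\<in>S. G i) * (\<Prod>i\<in>{1..n} - S. H i)) =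
      monom (c S * (\<Prod>i\<in>S. poly g (a i)) * (\<Prod>i\<in>{1..n} - S. poly h (a i))) (card S)" .
  qed
  \<comment> \<open>The exponent of the fresh indeterminate is \<open>card S\<close>, so its
    coefficient at \<open>d\<close> is the component of degree \<open>d\<close>.\<close>
  finally have "0 = coeff (\<Sum>S\<in>Pow {1..n}. monom
      (c S * (\<Prod>i\<in>S. poly g (a i)) * (\<Prod>i\<in>{1..n} - S. poly h (a i))) (card S)) d"
    by (simp only: coeff_0)
  also have "\<dots> = subset_form {1..n} c d (\<lambda>i. poly g (a i)) (\<lambda>i. poly h (a i))"
    unfolding subset_form_def coeff_sum
    by (rule sum.mono_neutral_cong_right) auto
  finally show ?thesis
    unfolding c_def by simp
qed

text \<open>The powers of a single indeterminate are distinct. The coefficient field may be finite,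
  so the extension from split arguments is carried out over this field instead.\<close>

lemma infinite_mpoly_fract: "infinite (UNIV :: 'a::field mpoly fract set)"
proof -
  have "inj (\<lambda>e. to_fract (Poly_Mapping.single (Poly_Mapping.single 0 e) 1 :: 'a mpoly))"
  proof (rule injI)
    fix e e' :: nat
    assume "to_fract (Poly_Mapping.single (Poly_Mapping.single 0 e) 1 :: 'a mpoly) =
      to_fract (Poly_Mapping.single (Poly_Mapping.single 0 e') 1)"
    then have "Poly_Mapping.keys (Poly_Mapping.single (Poly_Mapping.single (0::nat) e) (1::'a)) =
      Poly_Mapping.keys (Poly_Mapping.single (Poly_Mapping.single 0 e') (1::'a))"
      by (simp only: to_fract_eq_iff)
    then have "Poly_Mapping.single (0::nat) e = Poly_Mapping.single 0 e'"
      by simp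
    then show "e = e'"
      by (metis lookup_single_eq)
  qed
  then show ?thesis
    using finite_subset[OF subset_UNIV] infinite_iff_countable_subset by blast
qed

section \<open>Isolating coefficients, and the membership criterion\<close>

text \<open>A set \<open>S\<close> of the same size as \<open>T\<close> but different from it misses
  a point of \<open>T\<close> and has a point outside \<open>T\<close>. The first gives a zero
  \<open>H\<close> factor or the second a zero \<open>G\<close> factor, whichever alternative is
  assumed.\<close>

lemma subset_form_eq_coeff:
  fixes c :: "nat set \<Rightarrow> 'a::field"
  assumes I: "finite I" and T: "T \<subseteq> I" "card T = d"
    and zero: "(\<forall>i\<in>T. H i = 0) \<or> (\<forall>i\<in>I - T. G i = 0)"
  shows "subset_form I c d G H = c T * (\<Prod>i\<in>T. G i) * (\<Prod>i\<in>I - T. H i)"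
proof -
  have "subset_form I c d G H = (\<Sum>S\<in>{T}. c S * (\<Prod>i\<in>S. G i) * (\<Prod>i\<in>I - S. H i))"
    unfolding subset_form_def
  proof (rule sum.mono_neutral_right)
    show "\<forall>S\<in>{S. S \<subseteq> I \<and> card S = d} - {T}. c S * (\<Prod>i\<in>S. G i) * (\<Prod>i\<in>I - S. H i) = 0"
    proof
      fix S assume S: "S \<in> {S. S \<subseteq> I \<and> card S = d} - {T}"
      have fin: "finite S" "finite T" using S T I finite_subset by auto
      have "\<not> T \<subseteq> S" "\<not> S \<subseteq> T"
        using S T card_subset_eq[OF fin(1), of T] card_subset_eq[OF fin(2), of S] by auto
      then have "(\<Prod>i\<in>S. G i) = 0 \<or> (\<Prod>i\<in>I - S. H i) = 0"
        using zero fin I S T by (auto simp: prod_zero_iff)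
      then show "c S * (\<Prod>i\<in>S. G i) * (\<Prod>i\<in>I - S. H i) = 0" by auto
    qed
  qed (use I T in auto)
  then show ?thesis by simp
qed

lemma degree_prod_linear_le: "degree (\<Prod>j\<in>K. [:- b j, 1:] :: 'a::field poly) \<le> card K"
  by (cases "finite K") (simp_all add: degree_prod_eq_sum_degree)

theorem mainTheorem2:
  fixes k l n :: nat
    and a :: "nat \<Rightarrow> 'a::field"
    and Z :: "'a set"
    and p :: "'a mpoly"
  assumes distinct: "inj_on a {1..n}"
    and nonzero: "0 \<notin> Z"
    and size: "finite Z \<longrightarrow> int (card Z) \<ge> int n - int k - int l - 1"
    and poly: "p \<in> mpolys n"
    and multilinear: "multilinear p"
  shows "p \<in> rfe_vanishing_ideal n a k l \<longleftrightarrow>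
    (\<forall>m \<in> Poly_Mapping.keys p.
        \<not> monomial_degree m \<le> l \<and> \<not> int (monomial_degree m) \<ge> int n - int k) \<and>
    (\<forall>K L. K \<subseteq> {1..n} \<longrightarrow> L \<subseteq> {1..n} \<longrightarrow> K \<inter> L = {} \<longrightarrow> card K = k \<longrightarrow> card L = l \<longrightarrow>
        (\<forall>z \<in> Z.
           mpoly_eval (\<lambda>c. c)
             (\<lambda>i. z * ((\<Prod>j\<in>K. a i - a j) / (\<Prod>j\<in>L. a i - a j)))
             (mpoly_set_zero K (mpoly_pderivs L p)) = 0))"
    (is "?ideal \<longleftrightarrow> ?degrees \<and> ?evals")
proof -
  let ?I = "{1..n}"
  define c where "c S = Poly_Mapping.lookup p (squarefree_monomial S)" for S
  define \<Pi> where "\<Pi> K i = (\<Prod>j\<in>K. a i - a j)" for K i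
  define D where "D K L z = mpoly_eval (\<lambda>c. c) (\<lambda>i. z * (\<Pi> K i / \<Pi> L i))
    (mpoly_set_zero K (mpoly_pderivs L p))" for K L z
  have \<Pi>_poly: "\<Pi> K = (\<lambda>i. poly (\<Prod>j\<in>K. [:- a j, 1:]) (a i))" for K
    by (simp add: \<Pi>_def poly_prod fun_eq_iff)
  have \<Pi>_0_iff: "\<Pi> K i = 0 \<longleftrightarrow> i \<in> K" if "K \<subseteq> ?I" "i \<in> ?I" for K i
  proof -
    have "finite K"
      using that finite_subset by blast
    then have "\<Pi> K i = 0 \<longleftrightarrow> (\<exists>j\<in>K. a i = a j)"
      by (simp add: \<Pi>_def prod_zero_iff)
    also have "\<dots> \<longleftrightarrow> i \<in> K"
      using that distinct by (metis inj_on_def subsetD)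
    finally show ?thesis .
  qed
  have degrees_iff: "?degrees \<longleftrightarrow>
      (\<forall>S\<subseteq>?I. c S \<noteq> 0 \<longrightarrow> l < card S \<and> int (card S) < int n - int k)"
  proof
    assume deg: ?degrees
    show "\<forall>S\<subseteq>?I. c S \<noteq> 0 \<longrightarrow> l < card S \<and> int (card S) < int n - int k"
    proof (intro allI impI)
      fix S assume "S \<subseteq> ?I" "c S \<noteq> 0"
      then show "l < card S \<and> int (card S) < int n - int k"
        using deg[rule_format, of "squarefree_monomial S"] finite_subset[of S ?I]
        by (simp add: c_def in_keys_iff monomial_degree_squarefree_monomial)
    qed
  next
    assume S: "\<forall>S\<subseteq>?I. c S \<noteq> 0 \<longrightarrow> l < card S \<and> int (card S) < int n - int k"
    show ?degrees
    proof
      fix m assume m: "m \<in> Poly_Mapping.keys p"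
      then obtain T where T: "T \<subseteq> ?I" "m = squarefree_monomial T"
        using multilinear_keyE[OF multilinear poly] by blast
      then show "\<not> monomial_degree m \<le> l \<and> \<not> int (monomial_degree m) \<ge> int n - int k"
        using S[rule_format, of T] m finite_subset[of T ?I]
        by (simp add: c_def in_keys_iff monomial_degree_squarefree_monomial)
    qed
  qed
  have sum_eq_D: "(\<Sum>d\<le>n. subset_form ?I c d (\<Pi> K) (\<Pi> L) * z ^ d) =
      z ^ card L * (\<Prod>i\<in>L. \<Pi> K i) * (\<Prod>i\<in>?I - L. \<Pi> L i) * D K L z"
    if KL: "K \<subseteq> ?I" "L \<subseteq> ?I" "K \<inter> L = {}" for K L z
  proof -
    have "finite L" using KL finite_subset by blast
    then show ?thesis
      unfolding D_def mpoly_eval_set_zero_pderivs[OF multilinear poly \<open>finite L\<close> KL(3)]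
        c_def[symmetric]
      using KL \<Pi>_0_iff[OF KL(1)] \<Pi>_0_iff[OF KL(2)]
      by (subst scaled_sum_subset_form[of ?I L K, symmetric]) (auto simp del: One_nat_def)
  qed
  \<comment> \<open>This is the factor in \<open>sum_eq_D\<close> apart from the power of
    \<open>z\<close>; it can be cancelled because the products vanish only at their own
    indices.\<close>
  have unit: "(\<Prod>i\<in>L. \<Pi> K i) * (\<Prod>i\<in>?I - L. \<Pi> L i) \<noteq> 0"
    if KL: "K \<subseteq> ?I" "L \<subseteq> ?I" "K \<inter> L = {}" for K L
  proof -
    have "finite L" using KL finite_subset by blast
    moreover have "\<forall>i\<in>L. \<Pi> K i \<noteq> 0" "\<forall>i\<in>?I - L. \<Pi> L i \<noteq> 0"
      using KL \<Pi>_0_iff[OF KL(1)] \<Pi>_0_iff[OF KL(2)] by blast+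
    ultimately show ?thesis
      by (simp add: prod_zero_iff)
  qed
  have evals_iff: "?evals \<longleftrightarrow> (\<forall>K L. K \<subseteq> ?I \<longrightarrow> L \<subseteq> ?I \<longrightarrow> K \<inter> L = {} \<longrightarrow> card K = k \<longrightarrow> card L = l \<longrightarrow>
      (\<forall>z\<in>Z. D K L z = 0))"
    by (simp add: D_def \<Pi>_def)
  show ?thesis
    unfolding degrees_iff evals_iff
  proof (intro iffI conjI allI impI ballI)
    assume ideal: ?ideal
    have form_0: "subset_form ?I c d (\<Pi> K) (\<Pi> L) = 0" if "card K \<le> k" "card L \<le> l" for d K L
      unfolding \<Pi>_poly c_def
      by (rule rfe_vanishing_ideal_imp_subset_form_eq_0[OF multilinear poly ideal])
        (use that degree_prod_linear_le order_trans in blast)+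
    {
      fix T assume T: "T \<subseteq> ?I" "c T \<noteq> 0"
      have "finite T" using T finite_subset by blast
      show "l < card T"
      proof (rule ccontr)
        assume "\<not> l < card T"
        \<comment> \<open>The seed with numerator 1 and denominator vanishing exactly on
          \<open>T\<close> isolates \<open>c T\<close>.\<close>
        then have "subset_form ?I c (card T) (\<Pi> {}) (\<Pi> T) = 0"
          by (intro form_0) auto
        moreover have "subset_form ?I c (card T) (\<Pi> {}) (\<Pi> T) =
            c T * (\<Prod>i\<in>T. \<Pi> {} i) * (\<Prod>i\<in>?I - T. \<Pi> T i)"
          by (rule subset_form_eq_coeff) (use T \<Pi>_0_iff[OF T(1)] in blast)+
        ultimately show False
          using T unit[of "{}" T] by auto
      qed
      show "int (card T) < int n - int k"
      proof (rule ccontr)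
        assume "\<not> int (card T) < int n - int k"
        moreover have "card (?I - T) = n - card T"
          using T \<open>finite T\<close> by (simp add: card_Diff_subset)
        \<comment> \<open>The dual seed: the numerator vanishes exactly off \<open>T\<close>, with
          at most \<open>k\<close> roots, and the denominator is 1.\<close>
        ultimately have "subset_form ?I c (card T) (\<Pi> (?I - T)) (\<Pi> {}) = 0"
          by (intro form_0) auto
        moreover have "subset_form ?I c (card T) (\<Pi> (?I - T)) (\<Pi> {}) =
            c T * (\<Prod>i\<in>T. \<Pi> (?I - T) i) * (\<Prod>i\<in>?I - T. \<Pi> {} i)"
          by (rule subset_form_eq_coeff) (use T \<Pi>_0_iff[of "?I - T"] in blast)+
        moreover have "\<Pi> (?I - T) i \<noteq> 0" if "i \<in> T" for i
          using that T \<Pi>_0_iff[of "?I - T" i] by auto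
        moreover have "\<Pi> {} i = 1" for i
          by (simp add: \<Pi>_def)
        ultimately show False
          using T \<open>finite T\<close> by auto
      qed
    }
    {
      fix K L z
      assume KL: "K \<subseteq> ?I" "L \<subseteq> ?I" "K \<inter> L = {}" "card K = k" "card L = l" and "z \<in> Z"
      have "z \<noteq> 0" using \<open>z \<in> Z\<close> nonzero by auto
      moreover have "(\<Sum>d\<le>n. subset_form ?I c d (\<Pi> K) (\<Pi> L) * z ^ d) = 0"
        using form_0 KL by (intro sum.neutral) auto
      ultimately show "D K L z = 0"
        using sum_eq_D[OF KL(1-3), of z] unit[OF KL(1-3)] by auto
    }
  next
    assume "(\<forall>S\<subseteq>?I. c S \<noteq> 0 \<longrightarrow> l < card S \<and> int (card S) < int n - int k) \<and>
      (\<forall>K L. K \<subseteq> ?I \<longrightarrow> L \<subseteq> ?I \<longrightarrow> K \<inter> L = {} \<longrightarrow> card K = k \<longrightarrow> card L = l \<longrightarrow>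
        (\<forall>z\<in>Z. D K L z = 0))"
    then have deg: "\<And>S. S \<subseteq> ?I \<Longrightarrow> c S \<noteq> 0 \<Longrightarrow> l < card S \<and> int (card S) < int n - int k"
      and D0: "\<And>K L z. K \<subseteq> ?I \<Longrightarrow> L \<subseteq> ?I \<Longrightarrow> K \<inter> L = {} \<Longrightarrow> card K = k \<Longrightarrow> card L = l \<Longrightarrow>
        z \<in> Z \<Longrightarrow> D K L z = 0"
      by blast+
    have form_deg: "l < d \<and> int d < int n - int k" if "subset_form ?I c d G H \<noteq> 0" for d G H
    proof -
      obtain S where "S \<in> {S. S \<subseteq> ?I \<and> card S = d}"
        and "c S * (\<Prod>i\<in>S. G i) * (\<Prod>i\<in>?I - S. H i) \<noteq> 0"
        using \<open>subset_form ?I c d G H \<noteq> 0\<close> unfolding subset_form_def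
        by (rule sum.not_neutral_contains_not_neutral)
      then have "S \<subseteq> ?I" "card S = d" "c S \<noteq> 0"
        by auto
      then show ?thesis using deg by blast
    qed
    have form_0: "subset_form ?I c d (\<Pi> K) (\<Pi> L) = 0"
      if KL: "K \<subseteq> ?I" "L \<subseteq> ?I" "K \<inter> L = {}" "card K = k" "card L = l" for d K L
    proof -
      \<comment> \<open>The generating polynomial of the forms in \<open>z\<close>:
        \<open>sum_eq_D\<close> makes every element of \<open>Z\<close> a root, and the degree
        condition confines its exponents.\<close>
      define q where "q = (\<Sum>d\<le>n. monom (subset_form ?I c d (\<Pi> K) (\<Pi> L)) d)"
      have coeff_q: "coeff q d = (if d \<le> n then subset_form ?I c d (\<Pi> K) (\<Pi> L) else 0)" for d
        by (simp add: q_def coeff_sum)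
      have "q = 0"
      proof (rule poly_eq_0_if_nonzero_roots[OF _ nonzero _ ])
        show "l < d \<and> int d < int n - int k" if "coeff q d \<noteq> 0" for d
          using that form_deg by (auto simp: coeff_q split: if_splits)
        show "poly q z = 0" if "z \<in> Z" for z
          using sum_eq_D[OF KL(1-3), of z] D0[OF KL that] by (simp add: q_def poly_sum poly_monom)
      qed (use size in simp)
      \<comment> \<open>For \<open>d > n\<close> the coefficient of \<open>q\<close> says nothing
        about the form; there \<open>form_deg\<close> forces it to vanish.\<close>
      then show ?thesis
        using coeff_q[of d] form_deg[of d "\<Pi> K" "\<Pi> L"] by (force split: if_splits)
    qed
    \<comment> \<open>The identities at split arguments are transported to the fraction field, which
      is infinite and contains the coefficients of the generic seed.\<close>
    let ?\<phi> = "\<lambda>x. to_fract (mconst x) :: 'a mpoly fract"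
    have hom: "comm_ring_hom_fun ?\<phi>"
      using hom_mconst[where 'a = 'a] by (simp add: comm_ring_hom_fun_def)
    have \<phi>_diff: "?\<phi> (x - y) = ?\<phi> x - ?\<phi> y" for x y
      by (simp add: mconst_def single_diff)
    have \<phi>_inj: "x = y" if "?\<phi> x = ?\<phi> y" for x y
      using that by (simp add: mconst_def) (metis lookup_single_eq)
    have \<phi>0: "?\<phi> 0 = 0"
      using hom by (simp add: comm_ring_hom_fun_def)
    have inj: "inj_on (\<lambda>i. ?\<phi> (a i)) ?I"
      using distinct \<phi>_inj by (meson inj_on_def)
    have deg_seed: "degree (rfe_num k :: 'a mpoly fract poly) \<le> k"
      "degree (rfe_den k l :: 'a mpoly fract poly) \<le> l"
      unfolding rfe_num_def rfe_den_def
      by (auto intro!: degree_sum_le intro: order_trans[OF degree_monom_le])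
    have seed_0: "subset_form ?I (\<lambda>S. ?\<phi> (c S)) d (\<lambda>i. poly (rfe_num k) (?\<phi> (a i)))
        (\<lambda>i. poly (rfe_den k l) (?\<phi> (a i))) = 0" for d
    \<comment> \<open>Inside this range \<open>d\<close> meets both size hypotheses of the extension
      from split arguments; outside it the degree condition makes all coefficients of size
      \<open>d\<close> zero.\<close>
    proof (cases "l < d \<and> int d < int n - int k")
      case True
      show ?thesis
      proof (rule subset_form_eq_0[OF infinite_mpoly_fract _ inj _ _ _ deg_seed])
        fix K L assume KL: "K \<subseteq> ?I" "L \<subseteq> ?I" "K \<inter> L = {}" "card K = k" "card L = l"
        show "subset_form ?I (\<lambda>S. ?\<phi> (c S)) d (\<lambda>i. \<Prod>j\<in>K. ?\<phi> (a i) - ?\<phi> (a j))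
            (\<lambda>i. \<Prod>j\<in>L. ?\<phi> (a i) - ?\<phi> (a j)) = 0"
          using arg_cong[OF form_0[OF KL, of d], of ?\<phi>]
          unfolding subset_form_hom[OF hom] \<Pi>_def hom_prod[OF hom] \<phi>_diff \<phi>0 .
      qed (use True in auto)
    next
      case False
      have "c S = 0" if "S \<subseteq> ?I" "card S = d" for S
        using deg[of S] that False by blast
      then show ?thesis
        unfolding subset_form_def by (intro sum.neutral) (auto simp: \<phi>0)
    qed
    show ?ideal
      unfolding rfe_vanishing_ideal_iff_sum_eq_0[OF multilinear poly] c_def[symmetric]
        sum_Pow_by_card[OF finite_atLeastAtMost] subset_form_def[symmetric]
      using seed_0 by simp
  qed
qed

end
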